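(* Let $m\neq \frac12(r-n)$ be an integer and let $U,U'\in \operatorname{Gr}^m(V)$ be two rational points of the same index $m$. Then $U=U'$ if and only if $$T_2\Big(\frac{z_\bullet\cdot \psi_{u,U}(z_\bullet,t)}{(1,\dots,z_u,\dots,1)},\ \frac{\psi^*_{v,U'}(z_\bullet,t')}{z\,(1,\dots,z_v,\dots,1)}\Big)=0\qquad\text{for all }1\le u,v\le r$$ (identically in the two independent sets of variables $t,t'$).
   Context: The base field is $\mathbb C$. Fix positive integers $e_1,\dots,e_r$ and put $n=e_1+\dots+e_r$. Let $V=\prod_{i=1}^r V_i$ with $V_i=\mathbb C((z_i))$, and $V_+=\prod_{i=1}^r\mathbb C[[z_i]]$, regarded as algebras over $\mathbb C((z))$, $\mathbb C[[z]]$ via $z\mapsto (z_1^{e_1},\dots,z_r^{e_r})$ (so $z_i=z^{1/e_i}$). Write $z_\bullet=(z_1,\dots,z_r)$, $z_1^{a_1}\cdots z_r^{a_r}$ for the element $(z_1^{a_1},\dots,z_r^{a_r})\in V$, and $(1,\dots,z_u,\dots,1)$ for the element with $z_u$ in the $u$-th place; quotients are componentwise. $\operatorname{Gr}(V)$ is the infinite Grassmannian of $(V,V_+)$; its rational points are the subspaces $U\subset V$ such that $U\to V/V_+$ has finite dimensional kernel and cokernel, and $\operatorname{Gr}^m(V)$ is the component where $\dim\ker-\dim\operatorname{coker}=m$. Elements $v_m$. For $m\le\frac12(r-n)$ write $-m=q(n-r)-p$ with $0\le p<n-r$ (if $n=r$ put $q=0$, $p=m$), $p=sr+k$ with $0\le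 k<r$, and $v_m=(z^{-1}z_\bullet)^q z_1^{s+1}\cdots z_k^{s+1}z_{k+1}^s\cdots z_r^s$. For $m>\frac12(r-n)$ put $v_m=(z^{-1}z_\bullet)v_{r-n-m}^{-1}$. $\tau$-functions. $\Omega_+$ is the canonical section of the dual determinant bundle of $\operatorname{Gr}(V)$ given on $\operatorname{Gr}^m(V)$ by the determinant of $\mathcal L\to V/v_mV_+$, $\mathcal L$ the universal submodule. Let $t=(t^{(1)},\dots,t^{(r)})$, $t^{(j)}=(t^{(j)}_1,t^{(j)}_2,\dots)$. The formal Jacobian $\mathcal J$ is the formal spectrum of the completed tensor product over $j=1,\dots,r$ of the rings $\mathbb C\{\{t^{(j)}_1,t^{(j)}_2,\dots\}\}=\varprojlim_k\mathbb C[[t^{(j)}_1,\dots,t^{(j)}_k]]$; its universal element $\big(\exp(\sum_{i\ge1}t^{(1)}_i/z_1^i),\dots,\exp(\sum_{i\ge1}t^{(r)}_i/z_r^i)\big)$ acts on $V$ and $\operatorname{Gr}(V)$ by multiplication. Then $\tau_U\in\mathcal O(\mathcal J)$ is $\tau_U(g)=\Omega_+(gU)/(g\cdot\delta_U)$, where $\delta_U$ is a nonzero element of the fibre of the dual determinant bundle at $U$ and $g\mapsto g\cdot \delta_U$ is the resulting trivialization over $\mathcal J$; so $\tau_U$ is defined up to a nonzero constant. Baker-Akhiezer functions. Let $U_{uv}=(1,\dots,z_u,\dots,z_v^{-1},\dots,1)\cdot U$ (so $U_{uu}=U$) and let $t+[z_j]$ be obtained from $t$ by replacing $t^{(j)}_i$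 by $t^{(j)}_i+z_j^i/i$ for all $i$. For $1\le u\le r$, $\psi_{u,U}(z_\bullet,t)$ is the $V$-valued function whose $j$-th component is $$\psi^{(j)}_{u,U}(z_j,t)=\exp\Big(-\sum_{i\ge1}\frac{t^{(j)}_i}{z_j^i}\Big)\frac{\tau_{U_{uj}}(t+[z_j])}{\tau_U(t)}$$ (this presupposes that $\tau_U$ is not identically zero). Let $\operatorname{Tr}:V\to\mathbb C((z))$ be the trace of the $\mathbb C((z))$-algebra $V$, $T_2(a,b)=\operatorname{Res}_{z=0}\operatorname{Tr}(ab)\,dz$, and $U^\perp$ the orthogonal of $U$ for $T_2$. The adjoint function is $\psi^*_{u,U}(z_\bullet,t)=\psi_{u,U^\perp}(z_\bullet,-t)$; for $m\ne\frac12(r-n)$ its $j$-th component is $\exp(\sum_{i\ge1}t^{(j)}_i/z_j^i)\,\tau_{U_{ju}}(t-[z_j])/\tau_U(t)$. Normalization. For a given $U\in\operatorname{Gr}^m(V)$ the constants in the $\tau_{U_{ab}}$ are chosen compatibly: $\tau_{U_{aa}}=\tau_U$, and for every $u$ all coefficients (of monomials in $t$) of $\tau_U(t)\,v_m(1,\dots,z_u,\dots,1)^{-1}\psi_{u,U}(z_\bullet,t)$ lie in $U$ and all coefficients of $\tau_U(t)\,v_{r-n-m}(1,\dots,z_u,\dots,1)^{-1}\psi^*_{u,U}(z_\bullet,t)$ lie in $U^\perp$. *)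

theory Defs
  imports
    "HOL-Computational_Algebra.Formal_Laurent_Series"
    "HOL-Computational_Algebra.Fraction_Field"
    "HOL-Combinatorics.Permutations"
    "HOL-Library.Function_Algebras"
    "HOL-Library.Groups_Big_Fun"
    "HOL-Library.Multiset_Order"
    "HOL-Library.Countable"
begin

section \<open>Formal power series in arbitrarily many variables\<close>

text \<open>
  A monomial in the variables \<open>'v\<close> is a finite multiset of variables, and a series is an arbitrary
  family of coefficients indexed by monomials.  For countably many variables this is the projective
  limit, over the finite sets of variables, of the usual power series rings.
\<close>

typedef ('v, 'a) mps = "UNIV :: ('v multiset \<Rightarrow> 'a) set"
  morphisms mps_coeff Abs_mps ..

setup_lifting type_definition_mps

lemma mps_eqI: "(\<And>\<alpha>. mps_coeff f \<alpha> = mps_coeff g \<alpha>) \<Longrightarrow> f = g"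
  by (simp add: mps_coeff_inject[symmetric] fun_eq_iff)

lemma mps_coeff_Abs_mps [simp]: "mps_coeff (Abs_mps F) = F"
  by (simp add: Abs_mps_inverse)

lemma finite_submultisets: "finite {\<beta>. \<beta> \<subseteq># (\<alpha> :: 'v multiset)}"
proof (induction \<alpha>)
  case (add x \<alpha>)
  have "{\<beta>. \<beta> \<subseteq># add_mset x \<alpha>} \<subseteq> {\<beta>. \<beta> \<subseteq># \<alpha>} \<union> add_mset x ` {\<beta>. \<beta> \<subseteq># \<alpha>}"
  proof
    fix \<beta> assume "\<beta> \<in> {\<beta>. \<beta> \<subseteq># add_mset x \<alpha>}"
    then have sub: "\<beta> \<subseteq># add_mset x \<alpha>" by simp
    show "\<beta> \<in> {\<beta>. \<beta> \<subseteq># \<alpha>} \<union> add_mset x ` {\<beta>. \<beta> \<subseteq># \<alpha>}"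
    proof (cases "x \<in># \<beta>")
      case True
      then obtain \<gamma> where \<gamma>: "\<beta> = add_mset x \<gamma>" by (metis mset_add)
      with sub show ?thesis by simp
    next
      case False
      have "count \<beta> y \<le> count \<alpha> y" for y
        using False mset_subset_eq_count[OF sub, of y] by (cases "y = x") (simp_all add: not_in_iff)
      then show ?thesis by (simp add: mset_subset_eqI)
    qed
  qed
  with add.IH show ?case by (meson finite_UnI finite_imageI finite_subset)
qed simp

definition msplits :: "'v multiset \<Rightarrow> ('v multiset \<times> 'v multiset) set" where
  "msplits \<alpha> = {(\<beta>, \<gamma>). \<beta> + \<gamma> = \<alpha>}"

lemma mem_msplits: "(\<beta>, \<gamma>) \<in> msplits \<alpha> \<longleftrightarrow> \<beta> + \<gamma> = \<alpha>"
  by (simp add: msplits_def)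

lemma finite_msplits [simp]: "finite (msplits \<alpha>)"
proof -
  have "msplits \<alpha> \<subseteq> {\<beta>. \<beta> \<subseteq># \<alpha>} \<times> {\<beta>. \<beta> \<subseteq># \<alpha>}"
    by (auto simp: msplits_def)
  then show ?thesis
    by (rule finite_subset) (simp add: finite_submultisets)
qed

instantiation mps :: (type, comm_ring_1) comm_ring_1
begin

lift_definition zero_mps :: "('a, 'b) mps" is "\<lambda>_. 0" .
lift_definition one_mps :: "('a, 'b) mps" is "\<lambda>\<alpha>. if \<alpha> = {#} then 1 else 0" .
lift_definition plus_mps :: "('a, 'b) mps \<Rightarrow> ('a, 'b) mps \<Rightarrow> ('a, 'b) mps" is "\<lambda>f g \<alpha>. f \<alpha> + g \<alpha>" .
lift_definition minus_mps :: "('a, 'b) mps \<Rightarrow> ('a, 'b) mps \<Rightarrow> ('a, 'b) mps" is "\<lambda>f g \<alpha>. f \<alpha> - g \<alpha>" .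
lift_definition uminus_mps :: "('a, 'b) mps \<Rightarrow> ('a, 'b) mps" is "\<lambda>f \<alpha>. - f \<alpha>" .
lift_definition times_mps :: "('a, 'b) mps \<Rightarrow> ('a, 'b) mps \<Rightarrow> ('a, 'b) mps"
  is "\<lambda>f g \<alpha>. \<Sum>(\<beta>, \<gamma>)\<in>msplits \<alpha>. f \<beta> * g \<gamma>" .

instance
proof
  fix f g h :: "('a, 'b) mps"
  show "f * g * h = f * (g * h)"
  proof (transfer, rule ext)
    fix f g h :: "'a multiset \<Rightarrow> 'b" and \<alpha>
    have "(\<Sum>(\<delta>, \<gamma>)\<in>msplits \<alpha>. (\<Sum>(\<beta>, \<beta>')\<in>msplits \<delta>. f \<beta> * g \<beta>') * h \<gamma>)
      = (\<Sum>((\<delta>, \<gamma>), (\<beta>, \<beta>'))\<in>(SIGMA p:msplits \<alpha>. msplits (fst p)). f \<beta> * g \<beta>' * h \<gamma>)"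
      by (subst sum.Sigma[symmetric])
        (auto simp: case_prod_unfold sum_distrib_right intro!: sum.cong)
    also have "\<dots> = (\<Sum>((\<beta>, \<delta>), (\<beta>', \<gamma>))\<in>(SIGMA p:msplits \<alpha>. msplits (snd p)). f \<beta> * (g \<beta>' * h \<gamma>))"
      by (rule sum.reindex_bij_witness[
            where i = "\<lambda>((\<beta>, \<delta>), (\<beta>', \<gamma>)). ((\<beta> + \<beta>', \<gamma>), (\<beta>, \<beta>'))"
              and j = "\<lambda>((\<delta>, \<gamma>), (\<beta>, \<beta>')). ((\<beta>, \<beta>' + \<gamma>), (\<beta>', \<gamma>))"])
        (auto simp: msplits_def add.assoc mult.assoc)
    also have "\<dots> = (\<Sum>(\<beta>, \<delta>)\<in>msplits \<alpha>. f \<beta> * (\<Sum>(\<beta>', \<gamma>)\<in>msplits \<delta>. g \<beta>' * h \<gamma>))"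
      by (subst sum.Sigma[symmetric])
        (auto simp: case_prod_unfold sum_distrib_left intro!: sum.cong)
    finally show "(\<Sum>(\<delta>, \<gamma>)\<in>msplits \<alpha>. (\<Sum>(\<beta>, \<beta>')\<in>msplits \<delta>. f \<beta> * g \<beta>') * h \<gamma>)
      = (\<Sum>(\<beta>, \<delta>)\<in>msplits \<alpha>. f \<beta> * (\<Sum>(\<beta>', \<gamma>)\<in>msplits \<delta>. g \<beta>' * h \<gamma>))" .
  qed
  show "f * g = g * f"
  proof (transfer, rule ext)
    fix f g :: "'a multiset \<Rightarrow> 'b" and \<alpha>
    show "(\<Sum>(\<beta>, \<gamma>)\<in>msplits \<alpha>. f \<beta> * g \<gamma>) = (\<Sum>(\<beta>, \<gamma>)\<in>msplits \<alpha>. g \<beta> * f \<gamma>)"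
      by (rule sum.reindex_bij_witness[where i = prod.swap and j = prod.swap])
        (auto simp: msplits_def add.commute mult.commute)
  qed
  show "1 * f = f"
  proof (transfer, rule ext)
    fix f :: "'a multiset \<Rightarrow> 'b" and \<alpha>
    have "(\<Sum>(\<beta>, \<gamma>)\<in>msplits \<alpha>. (if \<beta> = {#} then 1 else 0) * f \<gamma>)
      = (\<Sum>(\<beta>, \<gamma>)\<in>{({#} :: 'a multiset, \<alpha>)}. (if \<beta> = {#} then 1 else 0) * f \<gamma>)"
      by (rule sum.mono_neutral_right) (auto simp: mem_msplits split: if_splits)
    then show "(\<Sum>(\<beta>, \<gamma>)\<in>msplits \<alpha>. (if \<beta> = {#} then 1 else 0) * f \<gamma>) = f \<alpha>"
      by simp
  qed
  show "(f + g) * h = f * h + g * h"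
    by (transfer, rule ext) (simp add: case_prod_unfold distrib_right sum.distrib)
  show "(0 :: ('a, 'b) mps) \<noteq> 1"
    by (transfer) (metis zero_neq_one)
qed (transfer; simp add: fun_eq_iff ac_simps; fail)+

end

text \<open>
  Multisets over a countable type are well-ordered through the multiset order on multisets of natural
  numbers, and the product of the two smallest terms cannot cancel.
\<close>

instance mps :: (countable, idom) idom
proof
  fix f g :: "('a, 'b) mps"
  assume f: "f \<noteq> 0" and g: "g \<noteq> 0"
  let ?k = "image_mset (to_nat :: 'a \<Rightarrow> nat)"
  have inj: "?k \<beta> = ?k \<gamma> \<longleftrightarrow> \<beta> = \<gamma>" for \<beta> \<gamma>
    using multiset.inj_map[OF inj_to_nat] by (auto dest: injD)
  have least: "\<exists>\<alpha>. mps_coeff h \<alpha> \<noteq> 0 \<and> (\<forall>\<beta>. mps_coeff h \<beta> \<noteq> 0 \<longrightarrow> ?k \<alpha> \<le> ?k \<beta>)"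
    if "h \<noteq> 0" for h :: "('a, 'b) mps"
  proof -
    from that obtain \<gamma> where "mps_coeff h \<gamma> \<noteq> 0"
      by (metis mps_eqI zero_mps.rep_eq)
    then have "\<exists>M. \<exists>\<alpha>. M = ?k \<alpha> \<and> mps_coeff h \<alpha> \<noteq> 0" by blast
    from LeastI_ex[OF this] obtain \<alpha>
      where "(LEAST M. \<exists>\<alpha>. M = ?k \<alpha> \<and> mps_coeff h \<alpha> \<noteq> 0) = ?k \<alpha>" "mps_coeff h \<alpha> \<noteq> 0" by blast
    then show ?thesis by (metis (mono_tags, lifting) Least_le)
  qed
  from least[OF f] obtain \<alpha> where
    \<alpha>: "mps_coeff f \<alpha> \<noteq> 0" "\<And>\<beta>. mps_coeff f \<beta> \<noteq> 0 \<Longrightarrow> ?k \<alpha> \<le> ?k \<beta>" by blast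
  from least[OF g] obtain \<beta> where
    \<beta>: "mps_coeff g \<beta> \<noteq> 0" "\<And>\<gamma>. mps_coeff g \<gamma> \<noteq> 0 \<Longrightarrow> ?k \<beta> \<le> ?k \<gamma>" by blast
  have only: "\<gamma> = \<alpha> \<and> \<delta> = \<beta>"
    if "\<gamma> + \<delta> = \<alpha> + \<beta>" "mps_coeff f \<gamma> \<noteq> 0" "mps_coeff g \<delta> \<noteq> 0" for \<gamma> \<delta>
  proof -
    have le: "?k \<alpha> \<le> ?k \<gamma>" "?k \<beta> \<le> ?k \<delta>" using \<alpha> \<beta> that by auto
    have "?k \<gamma> + ?k \<delta> = ?k \<alpha> + ?k \<beta>" using that(1) by (metis image_mset_union)
    then have "\<not> ?k \<alpha> < ?k \<gamma>"
      using add_less_le_mono[OF _ le(2), of "?k \<alpha>" "?k \<gamma>"] by (metis less_irrefl)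
    with le(1) have "?k \<alpha> = ?k \<gamma>" using order_le_imp_less_or_eq by blast
    then have "\<alpha> = \<gamma>" using inj by blast
    with that(1) show ?thesis by simp
  qed
  have "mps_coeff (f * g) (\<alpha> + \<beta>) = (\<Sum>(\<gamma>, \<delta>)\<in>msplits (\<alpha> + \<beta>). mps_coeff f \<gamma> * mps_coeff g \<delta>)"
    by transfer simp
  also have "\<dots> = (\<Sum>(\<gamma>, \<delta>)\<in>{(\<alpha>, \<beta>)}. mps_coeff f \<gamma> * mps_coeff g \<delta>)"
    by (rule sum.mono_neutral_right) (use only in \<open>auto simp: mem_msplits\<close>)
  also have "\<dots> \<noteq> 0" using \<alpha> \<beta> by simp
  finally show "f * g \<noteq> 0" by (metis zero_mps.rep_eq)
qed

definition mps_const :: "'a \<Rightarrow> ('v, 'a::comm_ring_1) mps" where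
  "mps_const c = Abs_mps (\<lambda>\<alpha>. if \<alpha> = {#} then c else 0)"

definition mps_var :: "'v \<Rightarrow> ('v, 'a::comm_ring_1) mps" where
  "mps_var x = Abs_mps (\<lambda>\<alpha>. if \<alpha> = {#x#} then 1 else 0)"

definition mps_map :: "('a \<Rightarrow> 'b) \<Rightarrow> ('v, 'a) mps \<Rightarrow> ('v, 'b) mps" where
  "mps_map h f = Abs_mps (\<lambda>\<alpha>. h (mps_coeff f \<alpha>))"

text \<open>\<open>f(t) \<mapsto> f(-t)\<close>\<close>

definition mps_neg_vars :: "('v, 'a::comm_ring_1) mps \<Rightarrow> ('v, 'a) mps" where
  "mps_neg_vars f = Abs_mps (\<lambda>\<alpha>. (-1) ^ size \<alpha> * mps_coeff f \<alpha>)"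

text \<open>
  The exponential series \<open>\<Sum>n. f^n / n!\<close>, for \<open>f\<close> without constant term: then \<open>f^n\<close> has no monomials
  of degree less than \<open>n\<close>, so the sum below is the full one.
\<close>

definition mps_exp :: "('v, 'a::field) mps \<Rightarrow> ('v, 'a) mps" where
  "mps_exp f = Abs_mps (\<lambda>\<alpha>. \<Sum>n\<le>size \<alpha>. mps_coeff (f ^ n) \<alpha> / of_nat (fact n))"

text \<open>
  Bilinear extension of \<open>h\<close> to series in two independent sets of variables:
  \<open>(\<Sum>\<^sub>\<alpha> a\<^sub>\<alpha> t^\<alpha>, \<Sum>\<^sub>\<beta> b\<^sub>\<beta> t'^\<beta>) \<mapsto> \<Sum>\<^sub>\<alpha>\<^sub>,\<^sub>\<beta> h a\<^sub>\<alpha> b\<^sub>\<beta> t^\<alpha> t'^\<beta>\<close>.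
\<close>

definition mps_outer ::
  "('a \<Rightarrow> 'b \<Rightarrow> 'c) \<Rightarrow> ('v multiset \<Rightarrow> 'a) \<Rightarrow> ('w multiset \<Rightarrow> 'b) \<Rightarrow> ('v + 'w, 'c) mps" where
  "mps_outer h a b = Abs_mps (\<lambda>\<gamma>.
     h (a (image_mset projl (filter_mset isl \<gamma>)))
       (b (image_mset projr (filter_mset (\<lambda>x. \<not> isl x) \<gamma>))))"


section \<open>The algebra \<open>V\<close>\<close>

text \<open>
  The places \<open>1,\<dots>,r\<close> are the elements of a finite linearly ordered type \<open>'r\<close>, so \<open>r\<close> is its cardinality,
  and the exponents \<open>e_1,\<dots>,e_r\<close> are a function \<open>e\<close> on it.  \<open>V\<close> is the whole type \<open>'r V\<close>,
  with the pointwise ring structure of functions.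
\<close>

type_synonym 'r V = "'r \<Rightarrow> complex fls"

definition V_scale :: "complex \<Rightarrow> 'r V \<Rightarrow> 'r V" where
  "V_scale c f = (\<lambda>i. fls_const c * f i)"

interpretation V: vector_space "V_scale :: complex \<Rightarrow> 'r V \<Rightarrow> 'r V"
proof
  fix a b :: complex and x y :: "'r V"
  show "V_scale a (x + y) = V_scale a x + V_scale a y"
    by (simp add: V_scale_def fun_eq_iff distrib_left)
  show "V_scale (a + b) x = V_scale a x + V_scale b x"
    by (simp add: V_scale_def fun_eq_iff distrib_right flip: fls_plus_const)
  show "V_scale a (V_scale b x) = V_scale (a * b) x"
    by (simp add: V_scale_def fun_eq_iff mult.assoc[symmetric] fls_const_mult_const)
  show "V_scale 1 x = x"
    by (simp add: V_scale_def)
qed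

text \<open>\<open>z_1^{a_1} \<dots> z_r^{a_r}\<close>, that is, the element \<open>(z_1^{a_1}, \<dots>, z_r^{a_r})\<close>\<close>

definition zpow :: "('r \<Rightarrow> int) \<Rightarrow> 'r V" where
  "zpow a = (\<lambda>i. fls_X_intpow (a i))"

text \<open>\<open>z_j^k\<close> in the place \<open>j\<close> and zero in the other places\<close>

definition zsingle :: "'r \<Rightarrow> int \<Rightarrow> 'r V" where
  "zsingle j k = (\<lambda>i. if i = j then fls_X_intpow k else 0)"

text \<open>\<open>zpow (\<lambda>_. k) * V_plus\<close> for the constant exponent \<open>k\<close>\<close>

definition V_filt :: "int \<Rightarrow> 'r V set" where
  "V_filt k = {f. \<forall>i. \<forall>l<k. fls_nth (f i) l = 0}"

abbreviation V_plus :: "'r V set" where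
  "V_plus \<equiv> V_filt 0"

text \<open>
  For \<open>f \<in> \<complex>((z_i))\<close> write \<open>f = \<Sum>a<e_i. f_a(z_i^{e_i}) z_i^a\<close>: the coordinate \<open>f_a \<in> \<complex>((z))\<close> of \<open>f\<close> in the
  \<open>\<complex>((z))\<close>-basis \<open>1, z_i, \<dots>, z_i^{e_i-1}\<close>.
\<close>

definition coord :: "nat \<Rightarrow> nat \<Rightarrow> complex fls \<Rightarrow> complex fls" where
  "coord d a f = Abs_fls (\<lambda>k. fls_nth f (int d * k + int a))"

text \<open>
  The trace over \<open>\<complex>((z))\<close> of multiplication by \<open>b\<close> on \<open>V\<close>: the sum of the diagonal entries of its
  matrix in the basis consisting of the \<open>z_i^a\<close> with \<open>0 \<le> a < e_i\<close>.
\<close>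

definition Tr :: "('r::finite \<Rightarrow> nat) \<Rightarrow> 'r V \<Rightarrow> complex fls" where
  "Tr e b = (\<Sum>i\<in>UNIV. \<Sum>a<e i. coord (e i) a ((b * zsingle i (int a)) i))"

definition T2 :: "('r::finite \<Rightarrow> nat) \<Rightarrow> 'r V \<Rightarrow> 'r V \<Rightarrow> complex" where
  "T2 e a b = fls_residue (Tr e (a * b))"

definition orth :: "('r::finite \<Rightarrow> nat) \<Rightarrow> 'r V set \<Rightarrow> 'r V set" where
  "orth e U = {b. \<forall>a\<in>U. T2 e a b = 0}"


section \<open>Rational points of the Grassmannian\<close>

text \<open>
  \<open>B\<close> is a basis of the kernel of \<open>U \<rightarrow> V / V_plus\<close>, and the classes of \<open>C\<close> form a basis of the
  cokernel \<open>V / (U + V_plus)\<close>.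
\<close>

definition Gr :: "int \<Rightarrow> 'r V set set" where
  "Gr m = {U. V.subspace U \<and>
     (\<exists>B C. finite B \<and> V.independent B \<and> V.span B = U \<inter> V_plus \<and>
            finite C \<and> V.independent C \<and> V.span C \<inter> V.span (U \<union> V_plus) = {0} \<and>
            V.span (C \<union> U \<union> V_plus) = UNIV \<and>
            m = int (card B) - int (card C))}"

text \<open>\<open>U_{uv} = (1, \<dots>, z_u, \<dots>, z_v^{-1}, \<dots>, 1) U\<close>\<close>

definition U_shift :: "'r \<Rightarrow> 'r \<Rightarrow> 'r V set \<Rightarrow> 'r V set" where
  "U_shift u v U = (\<lambda>x. zpow (\<lambda>i. of_bool (i = u) - of_bool (i = v)) * x) ` U"

definition n_of :: "('r::finite \<Rightarrow> nat) \<Rightarrow> int" where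
  "n_of e = (\<Sum>i\<in>UNIV. int (e i))"

definition r_of :: "('r::finite \<Rightarrow> nat) \<Rightarrow> int" where
  "r_of e = int (card (UNIV :: 'r set))"

text \<open>
  The exponents of \<open>v_m\<close>, that is, \<open>v_m = zpow (v_exp e m)\<close>; here \<open>z = zpow (int \<circ> e)\<close>.
  The representation \<open>-m = q (n - r) - p\<close> with \<open>0 \<le> p < n - r\<close> has \<open>p = m mod (n - r)\<close> and
  \<open>q = - (m div (n - r))\<close>.  The place \<open>i\<close> is among the first \<open>k\<close> places iff fewer than \<open>k\<close> places
  precede it.
\<close>

definition v_exp_low :: "('r::{finite,linorder} \<Rightarrow> nat) \<Rightarrow> int \<Rightarrow> 'r \<Rightarrow> int" where
  "v_exp_low e m i =
    (let N = n_of e - r_of e;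
         p = (if N = 0 then m else m mod N);
         q = (if N = 0 then 0 else - (m div N));
         s = p div r_of e;
         k = p mod r_of e
     in q * (1 - int (e i)) + (if int (card {j. j < i}) < k then s + 1 else s))"

definition v_exp :: "('r::{finite,linorder} \<Rightarrow> nat) \<Rightarrow> int \<Rightarrow> 'r \<Rightarrow> int" where
  "v_exp e m i =
    (if 2 * m \<le> r_of e - n_of e then v_exp_low e m i
     else (1 - int (e i)) - v_exp_low e (r_of e - n_of e - m) i)"


section \<open>Tau functions\<close>

text \<open>
  The variable \<open>t^{(j)}_i\<close>, \<open>i \<ge> 1\<close>, is \<open>(j, i - 1)\<close>; with this shift \<open>\<O>(J)\<close> is exactly the type
  \<open>'r OJ\<close>.  An element of the completed tensor product of \<open>\<complex>((z_j))\<close> and \<open>\<O>(J)\<close> is a series in \<open>t\<close> with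
  coefficients in \<open>\<complex>((z_j))\<close>.
\<close>

type_synonym 'r tvar = "'r \<times> nat"
type_synonym 'r OJ = "('r tvar, complex) mps"
type_synonym 'r OJz = "('r tvar, complex fls) mps"

text \<open>\<open>\<Sum>i\<ge>1. t^{(j)}_i / z_j^i\<close>\<close>

definition t_sum :: "'r \<Rightarrow> 'r OJz" where
  "t_sum j = Abs_mps (\<lambda>\<alpha>. \<Sum>i | \<alpha> = {#(j, i)#}. fls_X_intpow (- int (Suc i)))"

text \<open>The universal element \<open>g\<close> of \<open>J\<close> applied to \<open>x \<in> V\<close>\<close>

definition g_act :: "'r V \<Rightarrow> 'r \<Rightarrow> 'r OJz" where
  "g_act x = (\<lambda>j. mps_exp (t_sum j) * mps_const (x j))"

text \<open>The \<open>z_j^k\<close> with \<open>(j, k) \<in> V_index e m\<close> represent a (topological) basis of \<open>V / v_m V_plus\<close>.\<close>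

definition V_index :: "('r::{finite,linorder} \<Rightarrow> nat) \<Rightarrow> int \<Rightarrow> ('r \<times> int) set" where
  "V_index e m = {(j, k). k < v_exp e m j}"

text \<open>
  Nonzero elements \<open>\<delta>_U\<close> of the fibre of the dual determinant bundle at \<open>U \<in> Gr m\<close> are given by
  adapted bases of \<open>U\<close>.  For \<open>K\<close> large and \<open>F_K = z_\<bullet>^{-K} V_plus\<close>, the complex
  \<open>U \<rightarrow> V / v_m V_plus\<close> is quasi-isomorphic to \<open>U \<inter> F_K \<rightarrow> F_K / v_m V_plus\<close>, whose terms are
  finite dimensional of the same dimension; the second one has the basis of monomials.  An adapted
  basis restricts to bases of the \<open>U \<inter> F_K\<close> for all large \<open>K\<close>, compatibly with the monomials in
  \<open>F_{K+1} / F_K\<close>, and so gives a nonzero element of the fibre that does not depend on \<open>K\<close>.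
  Two adapted bases differ by a well-defined nonzero determinant.
\<close>

definition adapted_basis ::
  "('r::{finite,linorder} \<Rightarrow> nat) \<Rightarrow> int \<Rightarrow> 'r V set \<Rightarrow> ('r \<times> int \<Rightarrow> 'r V) \<Rightarrow> bool" where
  "adapted_basis e m U w \<longleftrightarrow>
     inj_on w (V_index e m) \<and> V.independent (w ` V_index e m) \<and> V.span (w ` V_index e m) = U \<and>
     finite {(j, k) \<in> V_index e m. w (j, k) - zsingle j k \<notin> V_filt (k + 1)}"

text \<open>The determinant of a matrix indexed by a finite set, by the Leibniz formula\<close>

definition det_on :: "'i set \<Rightarrow> ('i \<Rightarrow> 'i \<Rightarrow> 'a::comm_ring_1) \<Rightarrow> 'a" where
  "det_on S M = (\<Sum>p | p permutes S. of_int (sign p) * (\<Prod>i\<in>S. M i (p i)))"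

text \<open>
  The canonical section: the determinant of the map to \<open>V / v_m V_plus\<close> of the module with basis
  \<open>W\<close>, relative to this basis and to the monomials.  It is the limit of the determinants of the
  finite truncations, in the topology of \<open>\<O>(J)\<close>: each coefficient is eventually constant if
  \<open>W = g_act \<circ> w\<close> with \<open>w\<close> adapted.
\<close>

definition Omega_plus ::
  "('r::{finite,linorder} \<Rightarrow> nat) \<Rightarrow> int \<Rightarrow> ('r \<times> int \<Rightarrow> 'r \<Rightarrow> 'r OJz) \<Rightarrow> 'r OJ" where
  "Omega_plus e m W = Abs_mps (\<lambda>\<alpha>. THE c. \<forall>\<^sub>F K in sequentially.
     mps_coeff
       (det_on {(j, k) \<in> V_index e m. - int K \<le> k}
          (\<lambda>a (j, k). mps_map (\<lambda>f. fls_nth f k) (W a j))) \<alpha> = c)"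

text \<open>
  \<open>\<tau>_U(g) = \<Omega>_+(gU) / (g \<cdot> \<delta>_U)\<close>: if \<open>\<delta>_U\<close> is given by the adapted basis \<open>w\<close> of \<open>U\<close>, then
  \<open>g \<cdot> \<delta>_U\<close> is given by the basis \<open>g w\<close> of \<open>gU\<close>.
\<close>

definition is_tau :: "('r::{finite,linorder} \<Rightarrow> nat) \<Rightarrow> int \<Rightarrow> 'r V set \<Rightarrow> 'r OJ \<Rightarrow> bool" where
  "is_tau e m U \<tau> \<longleftrightarrow> (\<exists>w. adapted_basis e m U w \<and> \<tau> = Omega_plus e m (g_act \<circ> w))"

text \<open>
  \<open>\<tau>(t + [z_j])\<close>: every variable \<open>t^{(j)}_i\<close> is replaced by \<open>t^{(j)}_i + z_j^i / i\<close>.  Each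
  coefficient, of \<open>t^\<alpha> z_j^k\<close>, receives contributions from finitely many monomials \<open>t^\<gamma>\<close> of \<open>\<tau>\<close>.
\<close>

definition t_plus :: "'r \<Rightarrow> 'r tvar \<Rightarrow> ('r tvar, complex fps) mps" where
  "t_plus j x = mps_var x +
     mps_const (if fst x = j then fps_const (1 / of_nat (Suc (snd x))) * fps_X ^ Suc (snd x) else 0)"

definition tau_plus :: "'r \<Rightarrow> 'r OJ \<Rightarrow> 'r OJz" where
  "tau_plus j \<tau> = Abs_mps (\<lambda>\<alpha>. fps_to_fls (Abs_fps (\<lambda>k.
     Sum_any (\<lambda>\<gamma>. mps_coeff \<tau> \<gamma> * fps_nth (mps_coeff (\<Prod>x\<in>#\<gamma>. t_plus j x) \<alpha>) k))))"


section \<open>Baker-Akhiezer functions\<close>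

text \<open>
  The \<open>j\<close>-th component of a \<open>V\<close>-valued function lies in the fraction field of \<open>\<complex>((z_j))[[t]]\<close>.
\<close>

type_synonym 'r Vfun = "'r \<Rightarrow> 'r OJz fract"

text \<open>Multiplication by \<open>zpow a\<close>, and by \<open>\<sigma> \<in> \<O>(J)\<close>\<close>

definition zpow_mult :: "('r::finite \<Rightarrow> int) \<Rightarrow> 'r Vfun \<Rightarrow> 'r Vfun" where
  "zpow_mult a \<psi> = (\<lambda>j. Fract (mps_const (zpow a j)) 1 * \<psi> j)"

definition OJ_mult :: "'r::finite OJ \<Rightarrow> 'r Vfun \<Rightarrow> 'r Vfun" where
  "OJ_mult \<sigma> \<psi> = (\<lambda>j. Fract (mps_map fls_const \<sigma>) 1 * \<psi> j)"

text \<open>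
  In the following \<open>\<tau> a b\<close> is the chosen \<open>\<tau>\<close>-function of \<open>U_{ab}\<close>, and \<open>\<tau> u u\<close> is that of \<open>U_{uu} = U\<close>.
  The \<open>j\<close>-th component of \<open>\<psi>_{u,U}\<close> is \<open>ba_num \<tau> u j / \<tau>_U\<close>.
\<close>

definition ba_num :: "('r::finite \<Rightarrow> 'r \<Rightarrow> 'r OJ) \<Rightarrow> 'r \<Rightarrow> 'r \<Rightarrow> 'r OJz" where
  "ba_num \<tau> u j = mps_exp (- t_sum j) * tau_plus j (\<tau> u j)"

definition ba :: "('r::finite \<Rightarrow> 'r \<Rightarrow> 'r OJ) \<Rightarrow> 'r \<Rightarrow> 'r Vfun" where
  "ba \<tau> u = (\<lambda>j. Fract (ba_num \<tau> u j) (mps_map fls_const (\<tau> u u)))"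

text \<open>
  \<open>\<psi>_{u,W}(z_\<bullet>, -t)\<close>, where \<open>\<sigma> a b\<close> is the chosen \<open>\<tau>\<close>-function of \<open>W_{ab}\<close>.  For \<open>W = U\<^sup>\<bottom>\<close> this is
  the adjoint function \<open>\<psi>*_{u,U}\<close>.
\<close>

definition ba_adj :: "('r::finite \<Rightarrow> 'r \<Rightarrow> 'r OJ) \<Rightarrow> 'r \<Rightarrow> 'r Vfun" where
  "ba_adj \<sigma> u = (\<lambda>j. Fract (mps_neg_vars (ba_num \<sigma> u j))
                            (mps_neg_vars (mps_map fls_const (\<sigma> u u))))"

text \<open>\<open>\<psi>\<close> has no denominator, and all its coefficients, of monomials in \<open>t\<close>, lie in \<open>U\<close>.\<close>

definition coeffs_in :: "'r::finite V set \<Rightarrow> 'r Vfun \<Rightarrow> bool" where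
  "coeffs_in U \<psi> \<longleftrightarrow>
     (\<exists>F. (\<forall>j. \<psi> j = Fract (F j) 1) \<and> (\<forall>\<alpha>. (\<lambda>j. mps_coeff (F j) \<alpha>) \<in> U))"

text \<open>
  A choice of \<open>\<tau>\<close>-functions of the \<open>U_{ab}\<close> that is not identically zero for \<open>U\<close> itself, so that the
  Baker-Akhiezer functions of \<open>U\<close> are defined.
\<close>

definition tau_system ::
  "('r::{finite,linorder} \<Rightarrow> nat) \<Rightarrow> int \<Rightarrow> 'r V set \<Rightarrow> ('r \<Rightarrow> 'r \<Rightarrow> 'r OJ) \<Rightarrow> bool" where
  "tau_system e m U \<tau> \<longleftrightarrow>
     (\<forall>a b. is_tau e m (U_shift a b U) (\<tau> a b)) \<and> (\<forall>a b. \<tau> a a = \<tau> b b) \<and> (\<forall>a. \<tau> a a \<noteq> 0)"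

text \<open>
  The normalization of the constants in the \<open>\<tau>\<close>-functions \<open>\<tau> a b\<close> of \<open>U_{ab}\<close>, which enter \<open>\<psi>_{u,U}\<close>,
  and \<open>\<sigma> a b\<close> of \<open>(U\<^sup>\<bottom>)_{ab}\<close>, which enter \<open>\<psi>*_{u,U}\<close>.  Since \<open>(U\<^sup>\<bottom>)_{ab} = (U_{ba})\<^sup>\<bottom>\<close>, the
  series \<open>\<sigma> a b\<close> and \<open>\<tau> b a\<close> at \<open>-t\<close> agree up to a nonzero constant, if \<open>2 m \<noteq> r - n\<close>.  These
  constants cannot be required to be \<open>1\<close>: if \<open>u \<noteq> v\<close> and the constant terms of \<open>\<tau>_U\<close> and
  \<open>\<tau>_{U_{uv}}\<close> do not vanish, then orthogonality of \<open>U\<close> and \<open>U\<^sup>\<bottom>\<close> forces the ratio of the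
  constants of \<open>\<tau> u v\<close> (in \<open>\<psi>_{u,U}\<close>) and \<open>\<sigma> v u\<close> (in \<open>\<psi>*_{v,U}\<close>) to be \<open>-e_u / e_v\<close>.
\<close>

definition normalized ::
  "('r::{finite,linorder} \<Rightarrow> nat) \<Rightarrow> int \<Rightarrow> 'r V set \<Rightarrow>
   ('r \<Rightarrow> 'r \<Rightarrow> 'r OJ) \<Rightarrow> ('r \<Rightarrow> 'r \<Rightarrow> 'r OJ) \<Rightarrow> bool" where
  "normalized e m U \<tau> \<sigma> \<longleftrightarrow>
     tau_system e m U \<tau> \<and> tau_system e (r_of e - n_of e - m) (orth e U) \<sigma> \<and>
     (\<forall>u. coeffs_in U
        (OJ_mult (\<tau> u u) (zpow_mult (\<lambda>j. v_exp e m j - of_bool (j = u)) (ba \<tau> u)))) \<and>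
     (\<forall>u. coeffs_in (orth e U)
        (OJ_mult (\<tau> u u)
          (zpow_mult (\<lambda>j. v_exp e (r_of e - n_of e - m) j - of_bool (j = u)) (ba_adj \<sigma> u))))"

text \<open>
  \<open>T_2\<close> for \<open>V\<close>-valued functions of \<open>t\<close> and of \<open>t'\<close>, extended by
  \<open>T_2 (A(t) / \<rho>(t)) (B(t') / \<rho>'(t')) = T_2 (A(t)) (B(t')) / (\<rho>(t) \<rho>'(t'))\<close>, where \<open>T_2\<close> is
  applied coefficientwise on the right.  The denominators are taken in \<open>\<O>(J)\<close>, and the value does
  not depend on the representation.
\<close>

definition T2_fun ::
  "('r::finite \<Rightarrow> nat) \<Rightarrow> 'r Vfun \<Rightarrow> 'r Vfun \<Rightarrow> ('r tvar + 'r tvar, complex) mps fract" where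
  "T2_fun e \<psi> \<phi> = (THE x. \<exists>A \<rho> B \<rho>'. \<rho> \<noteq> 0 \<and> \<rho>' \<noteq> 0 \<and>
     (\<forall>j. \<psi> j = Fract (A j) (mps_map fls_const \<rho>)) \<and>
     (\<forall>j. \<phi> j = Fract (B j) (mps_map fls_const \<rho>')) \<and>
     x = Fract
       (mps_outer (T2 e) (\<lambda>\<alpha> j. mps_coeff (A j) \<alpha>) (\<lambda>\<beta> j. mps_coeff (B j) \<beta>))
       (mps_outer (*) (mps_coeff \<rho>) (mps_coeff \<rho>')))"

end

theory Submission
  imports Defs "Jordan_Normal_Form.Determinant"
begin

text \<open>
  After the denominators have been cleared, the two arguments of \<open>T2\<close> are the series
  \<open>X_u(t) = \<tau>_U v_m (1, \<dots>, z_u, \<dots>, 1)^{-1} \<psi>_{u,U}\<close> and the analogous \<open>X'_v(t')\<close> for \<open>U'\<^sup>\<bottom>\<close>, because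
  \<open>v_m v_{r-n-m} = z^{-1} z_\<bullet>\<close>.  So the bilinear identity says that every coefficient of every \<open>X_u\<close> is
  orthogonal to every coefficient of every \<open>X'_v\<close> (\<open>T2_fun_ba_eq_0_iff\<close>).  By the normalization these
  coefficients lie in \<open>U\<close> and in \<open>U'\<^sup>\<bottom>\<close> (\<open>normalized_ba_vec_in\<close>, \<open>normalized_adj_ba_vec_in\<close>), which
  proves the identity if \<open>U = U'\<close>.

  For the converse the point is that the coefficients of the \<open>X_u\<close> span \<open>U\<close>, and those of the \<open>X'_v\<close> span
  \<open>U'\<^sup>\<bottom>\<close> (\<open>ba_vec_coeffs_span\<close>, used for both).  Then \<open>U\<close> is orthogonal to \<open>U'\<^sup>\<bottom>\<close>, hence contained in
  \<open>U'\<^sup>\<bottom>\<^sup>\<bottom> = U'\<close> (\<open>orth_separates_Gr\<close>), and nested points of the same index are equal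
  (\<open>Gr_subset_imp_eq\<close>).

  The spanning statement holds for the following reason.  Let \<open>g\<close> be the universal element of the formal
  Jacobian.  Modulo \<open>v_m V_plus\<close> the series \<open>g X_u\<close> consists of one term, with a pole of order one
  relative to \<open>v_m\<close> in the place \<open>u\<close> and with the coefficient \<open>\<tau>_U\<close>, and differentiating \<open>X_u\<close> with respect to \<open>t^{(u)}_i\<close> raises this pole order
  by \<open>i\<close>.  So these derivatives have a triangular system of leading terms in \<open>V / v_m V_plus\<close>.  As
  \<open>\<tau>_U \<noteq> 0\<close>, the map from \<open>g U\<close> to \<open>V / v_m V_plus\<close> is generically an isomorphism, and a subspace of \<open>U\<close> that
  contains all coefficients of these derivatives must be all of \<open>U\<close>.  The lemma \<open>span_criterion\<close> makes
  this precise with truncated determinants and Cramer's rule.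
\<close>

section \<open>Arithmetic of power series\<close>

lemma mps_coeff_zero [simp]: "mps_coeff 0 \<alpha> = 0"
  and mps_coeff_one: "mps_coeff 1 \<alpha> = (if \<alpha> = {#} then 1 else 0)"
  and mps_coeff_add [simp]: "mps_coeff (f + g) \<alpha> = mps_coeff f \<alpha> + mps_coeff g \<alpha>"
  and mps_coeff_diff [simp]: "mps_coeff (f - g) \<alpha> = mps_coeff f \<alpha> - mps_coeff g \<alpha>"
  and mps_coeff_uminus [simp]: "mps_coeff (- f) \<alpha> = - mps_coeff f \<alpha>"
  and mps_coeff_mult:
    "mps_coeff (f * g) \<alpha> = (\<Sum>(\<beta>, \<gamma>)\<in>msplits \<alpha>. mps_coeff f \<beta> * mps_coeff g \<gamma>)"
  by (transfer; simp)+

lemma mps_coeff_sum [simp]: "mps_coeff (\<Sum>i\<in>A. f i) \<alpha> = (\<Sum>i\<in>A. mps_coeff (f i) \<alpha>)"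
  by (induction A rule: infinite_finite_induct) simp_all

lemma mps_nonzero: "f \<noteq> 0 \<Longrightarrow> \<exists>\<alpha>. mps_coeff f \<alpha> \<noteq> 0"
  by (metis mps_eqI mps_coeff_zero)

lemma mps_coeff_const: "mps_coeff (mps_const c) \<alpha> = (if \<alpha> = {#} then c else 0)"
  by (simp add: mps_const_def)

lemma mps_coeff_map [simp]: "mps_coeff (mps_map h f) \<alpha> = h (mps_coeff f \<alpha>)"
  by (simp add: mps_map_def)

lemma mps_coeff_neg_vars [simp]: "mps_coeff (mps_neg_vars f) \<alpha> = (-1) ^ size \<alpha> * mps_coeff f \<alpha>"
  by (simp add: mps_neg_vars_def)

lemma mps_coeff_const_mult [simp]:
  fixes f :: "('v, 'a::comm_ring_1) mps"
  shows "mps_coeff (mps_const c * f) \<alpha> = c * mps_coeff f \<alpha>"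
proof -
  have "(\<Sum>(\<beta>, \<gamma>)\<in>msplits \<alpha>. mps_coeff (mps_const c) \<beta> * mps_coeff f \<gamma>)
      = (\<Sum>(\<beta>, \<gamma>)\<in>{({#} :: 'v multiset, \<alpha>)}. mps_coeff (mps_const c) \<beta> * mps_coeff f \<gamma>)"
    by (rule sum.mono_neutral_right) (auto simp: mem_msplits mps_coeff_const split: if_splits)
  then show ?thesis
    by (simp add: mps_coeff_mult mps_coeff_const)
qed

lemma mps_coeff_mult_const [simp]: "mps_coeff (f * mps_const c) \<alpha> = mps_coeff f \<alpha> * c"
  by (metis mps_coeff_const_mult mult.commute)

lemma mps_coeff_mult_empty [simp]:
  fixes f :: "('v, 'a::comm_ring_1) mps"
  shows "mps_coeff (f * g) {#} = mps_coeff f {#} * mps_coeff g {#}"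
proof -
  have "msplits ({#} :: 'v multiset) = {({#}, {#})}" by (auto simp: mem_msplits)
  then show ?thesis by (simp add: mps_coeff_mult)
qed

lemma mps_map_fls_const_eq_0_iff [simp]: "mps_map fls_const f = 0 \<longleftrightarrow> f = 0"
proof
  assume *: "mps_map fls_const f = 0"
  show "f = 0"
  proof (rule mps_eqI)
    fix \<alpha> show "mps_coeff f \<alpha> = mps_coeff 0 \<alpha>"
      using arg_cong[OF *, of "\<lambda>g. mps_coeff g \<alpha>"] by simp
  qed
qed (auto intro: mps_eqI)

lemma mps_neg_vars_mult: "mps_neg_vars (f * g) = mps_neg_vars f * mps_neg_vars g"
  by (rule mps_eqI)
    (auto simp: mps_coeff_mult sum_distrib_left mem_msplits power_add algebra_simps intro!: sum.cong)

lemma mps_neg_vars_neg_vars [simp]: "mps_neg_vars (mps_neg_vars f) = f"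
  by (rule mps_eqI) (simp add: mult.assoc[symmetric] power_mult_distrib[symmetric])

lemma mps_neg_vars_eq_0_iff [simp]: "mps_neg_vars f = 0 \<longleftrightarrow> f = 0"
proof -
  have "mps_neg_vars (0 :: ('a, 'b) mps) = 0" by (rule mps_eqI) simp
  then show ?thesis by (metis mps_neg_vars_neg_vars)
qed

lemma mps_neg_vars_const: "mps_neg_vars (mps_const c) = mps_const c"
  by (rule mps_eqI) (simp add: mps_coeff_const)

lemma mps_neg_vars_map_fls_const:
  "mps_neg_vars (mps_map fls_const f) = mps_map fls_const (mps_neg_vars (f :: ('v, complex) mps))"
proof (rule mps_eqI)
  fix \<alpha>
  have "(-1) ^ n * fls_const c = fls_const ((-1) ^ n * c)" for n and c :: complex
    by (induction n) (simp_all add: fls_const_mult_const)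
  then show "mps_coeff (mps_neg_vars (mps_map fls_const f)) \<alpha>
      = mps_coeff (mps_map fls_const (mps_neg_vars f)) \<alpha>" by simp
qed

section \<open>Exponentials\<close>

definition mps_pderiv :: "'v \<Rightarrow> ('v, 'a::comm_ring_1) mps \<Rightarrow> ('v, 'a) mps" where
  "mps_pderiv x f = Abs_mps (\<lambda>\<alpha>. of_nat (Suc (count \<alpha> x)) * mps_coeff f (add_mset x \<alpha>))"

lemma mps_coeff_pderiv:
  "mps_coeff (mps_pderiv x f) \<alpha> = of_nat (Suc (count \<alpha> x)) * mps_coeff f (add_mset x \<alpha>)"
  by (simp add: mps_pderiv_def)

text \<open>
  The Leibniz rule: the exponent of \<open>x\<close> in a product of two monomials is the sum of its exponents in the
  factors, which splits the sum over \<open>msplits (add_mset x \<alpha>)\<close> into the two terms on the right.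
\<close>

lemma mps_pderiv_mult: "mps_pderiv x (f * g) = mps_pderiv x f * g + f * mps_pderiv x g"
proof (rule mps_eqI)
  fix \<alpha>
  let ?M = "msplits (add_mset x \<alpha>)"
  have left: "(\<Sum>(\<beta>, \<gamma>)\<in>?M. of_nat (count \<beta> x) * mps_coeff f \<beta> * mps_coeff g \<gamma>)
      = mps_coeff (mps_pderiv x f * g) \<alpha>" for f g :: "('a, 'b) mps"
  proof -
    have "(\<Sum>(\<beta>, \<gamma>)\<in>?M. of_nat (count \<beta> x) * mps_coeff f \<beta> * mps_coeff g \<gamma>)
      = (\<Sum>(\<beta>, \<gamma>)\<in>{(\<beta>, \<gamma>) \<in> ?M. x \<in># \<beta>}. of_nat (count \<beta> x) * mps_coeff f \<beta> * mps_coeff g \<gamma>)"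
      by (rule sum.mono_neutral_right) (auto, metis count_eq_zero_iff mult_zero_left of_nat_0)
    also have "\<dots> = mps_coeff (mps_pderiv x f * g) \<alpha>"
      unfolding mps_coeff_mult mps_coeff_pderiv
      by (rule sum.reindex_bij_witness[where i = "\<lambda>(\<beta>, \<gamma>). (add_mset x \<beta>, \<gamma>)"
            and j = "\<lambda>(\<beta>, \<gamma>). (\<beta> - {#x#}, \<gamma>)"])
        (auto simp: mem_msplits dest!: multi_member_split)
    finally show ?thesis .
  qed
  have swap: "(\<Sum>(\<beta>, \<gamma>)\<in>?M. F \<beta> \<gamma>) = (\<Sum>(\<beta>, \<gamma>)\<in>?M. F \<gamma> \<beta>)" for F :: "_ \<Rightarrow> _ \<Rightarrow> 'b"
    by (rule sum.reindex_bij_witness[where i = prod.swap and j = prod.swap])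
      (auto simp: msplits_def add.commute)
  have "mps_coeff (mps_pderiv x (f * g)) \<alpha>
      = (\<Sum>(\<beta>, \<gamma>)\<in>?M. of_nat (Suc (count \<alpha> x)) * (mps_coeff f \<beta> * mps_coeff g \<gamma>))"
    by (simp add: mps_coeff_pderiv mps_coeff_mult sum_distrib_left case_prod_unfold)
  also have "\<dots> = (\<Sum>(\<beta>, \<gamma>)\<in>?M. of_nat (count \<beta> x) * mps_coeff f \<beta> * mps_coeff g \<gamma>)
      + (\<Sum>(\<beta>, \<gamma>)\<in>?M. of_nat (count \<gamma> x) * mps_coeff g \<gamma> * mps_coeff f \<beta>)"
  proof -
    have "of_nat (Suc (count \<alpha> x)) * c = of_nat (count \<beta> x) * c + of_nat (count \<gamma> x) * c"
      if "(\<beta>, \<gamma>) \<in> ?M" for \<beta> \<gamma> and c :: 'b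
    proof -
      have "Suc (count \<alpha> x) = count \<beta> x + count \<gamma> x"
        using arg_cong[of _ _ "\<lambda>\<mu>. count \<mu> x", OF that[unfolded mem_msplits]] by simp
      then show ?thesis by (simp only: of_nat_add distrib_right)
    qed
    then show ?thesis
      unfolding sum.distrib[symmetric]
      by (intro sum.cong) (auto simp: ac_simps distrib_left simp del: of_nat_Suc)
  qed
  also have "\<dots> = mps_coeff (mps_pderiv x f * g) \<alpha> + mps_coeff (mps_pderiv x g * f) \<alpha>"
    using left[of f g] left[of g f] swap[of "\<lambda>\<gamma> \<beta>. of_nat (count \<gamma> x) * mps_coeff g \<gamma> * mps_coeff f \<beta>"]
    by simp
  finally show "mps_coeff (mps_pderiv x (f * g)) \<alpha> = mps_coeff (mps_pderiv x f * g + f * mps_pderiv x g) \<alpha>"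
    by (simp add: mult.commute)
qed

lemma mps_pderiv_power: "mps_pderiv x (f ^ Suc n) = of_nat (Suc n) * (f ^ n * mps_pderiv x f)"
proof (induction n)
  case (Suc n)
  have "mps_pderiv x (f ^ Suc (Suc n)) = mps_pderiv x f * f ^ Suc n + f * mps_pderiv x (f ^ Suc n)"
    by (subst power_Suc) (rule mps_pderiv_mult)
  with Suc show ?case by (simp add: algebra_simps)
qed simp

lemma mps_coeff_of_nat_mult [simp]: "mps_coeff (of_nat n * f) \<alpha> = of_nat n * mps_coeff f \<alpha>"
  by (induction n) (simp_all add: algebra_simps)

lemma mps_coeff_power_eq_0:
  assumes "mps_coeff f {#} = 0" "size \<alpha> < n"
  shows "mps_coeff (f ^ n) \<alpha> = 0"
  using assms(2)
proof (induction n arbitrary: \<alpha>)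
  case (Suc n)
  have "mps_coeff f \<beta> * mps_coeff (f ^ n) \<gamma> = 0" if "\<beta> + \<gamma> = \<alpha>" for \<beta> \<gamma>
  proof (cases "\<beta> = {#}")
    case False
    then have "size \<gamma> < n" using that Suc.prems by (auto simp: size_eq_Suc_imp_elem nonempty_has_size)
    then show ?thesis using Suc.IH by simp
  qed (use assms in simp)
  then show ?case by (auto simp: mps_coeff_mult mem_msplits intro!: sum.neutral)
qed simp

lemma mps_coeff_exp:
  assumes "mps_coeff f {#} = 0" "size \<alpha> \<le> N"
  shows "mps_coeff (mps_exp f) \<alpha> = (\<Sum>n\<le>N. mps_coeff (f ^ n) \<alpha> / of_nat (fact n))"
  unfolding mps_exp_def mps_coeff_Abs_mps
  by (rule sum.mono_neutral_left) (use assms in \<open>auto simp: mps_coeff_power_eq_0\<close>)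

lemma mps_pderiv_exp:
  fixes f :: "('v, 'a::field_char_0) mps"
  assumes "mps_coeff f {#} = 0"
  shows "mps_pderiv x (mps_exp f) = mps_exp f * mps_pderiv x f"
proof (rule mps_eqI)
  fix \<alpha> :: "'v multiset"
  let ?N = "size \<alpha>"
  have "mps_coeff (mps_pderiv x (mps_exp f)) \<alpha>
      = (\<Sum>n\<le>Suc ?N. mps_coeff (mps_pderiv x (f ^ n)) \<alpha> / of_nat (fact n))"
    using assms by (simp add: mps_coeff_pderiv mps_coeff_exp[of f _ "Suc ?N"] sum_distrib_left del: sum.atMost_Suc)
  also have "\<dots> = (\<Sum>n\<le>?N. mps_coeff (mps_pderiv x (f ^ Suc n)) \<alpha> / of_nat (fact (Suc n)))"
    by (subst sum.atMost_Suc_shift) (simp add: mps_coeff_pderiv mps_coeff_one del: power_Suc)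
  also have "\<dots> = (\<Sum>n\<le>?N. mps_coeff (f ^ n * mps_pderiv x f) \<alpha> / of_nat (fact n))"
    unfolding mps_pderiv_power mps_coeff_of_nat_mult
    by (rule sum.cong) (simp_all add: fact_Suc[where 'a = nat] of_nat_mult del: of_nat_Suc of_nat_fact fact_Suc mult_Suc)
  also have "\<dots> = (\<Sum>(\<beta>, \<gamma>)\<in>msplits \<alpha>.
      (\<Sum>n\<le>?N. mps_coeff (f ^ n) \<beta> / of_nat (fact n)) * mps_coeff (mps_pderiv x f) \<gamma>)"
    unfolding mps_coeff_mult case_prod_unfold sum_divide_distrib sum_distrib_right
    by (subst sum.swap) simp
  also have "\<dots> = mps_coeff (mps_exp f * mps_pderiv x f) \<alpha>"
    unfolding mps_coeff_mult
    by (rule sum.cong) (auto simp: mem_msplits mps_coeff_exp[OF assms, of _ ?N])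
  finally show "mps_coeff (mps_pderiv x (mps_exp f)) \<alpha> = mps_coeff (mps_exp f * mps_pderiv x f) \<alpha>" .
qed

text \<open>The product has the constant term \<open>1\<close>, and all its partial derivatives vanish.\<close>

lemma mps_exp_mult_exp_uminus:
  fixes f :: "('v, 'a::field_char_0) mps"
  assumes "mps_coeff f {#} = 0"
  shows "mps_exp f * mps_exp (- f) = 1"
proof (rule mps_eqI)
  fix \<alpha>
  have neg: "mps_coeff (- f) {#} = 0" using assms by simp
  have [simp]: "mps_pderiv x (- f) = - mps_pderiv x f" for x
    by (rule mps_eqI) (simp add: mps_coeff_pderiv algebra_simps)
  have "mps_pderiv x (mps_exp f * mps_exp (- f)) = 0" for x
    by (simp add: mps_pderiv_mult mps_pderiv_exp[OF assms] mps_pderiv_exp[OF neg] algebra_simps)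
  then have *: "mps_coeff (mps_exp f * mps_exp (- f)) (add_mset x \<alpha>) = 0" for x \<alpha>
    using mps_coeff_pderiv[of x "mps_exp f * mps_exp (- f)" \<alpha>] by (simp del: of_nat_Suc)
  show "mps_coeff (mps_exp f * mps_exp (- f)) \<alpha> = mps_coeff 1 \<alpha>"
  proof (cases \<alpha>)
    case empty
    then show ?thesis using assms neg
      by (simp add: mps_coeff_one mps_coeff_exp[of _ _ 0])
  next
    case (add x \<beta>)
    then show ?thesis using * by (simp add: mps_coeff_one)
  qed
qed

section \<open>The filtration by weight\<close>

text \<open>
  The variable \<open>t^{(j)}_i\<close> has weight \<open>i\<close>.  Only finitely many monomials have weight at most \<open>Q\<close>, so a
  sequence of series tends to zero coefficientwise iff it eventually lies in each \<open>wt_ideal Q\<close>.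
  Unlike coefficientwise convergence itself, this form is visibly compatible with the cancellation
  of factors.
\<close>

definition wt :: "'r tvar multiset \<Rightarrow> nat" where
  "wt \<alpha> = (\<Sum>x\<in>#\<alpha>. Suc (snd x))"

definition wt_ideal :: "nat \<Rightarrow> 'r OJ set" where
  "wt_ideal Q = {f. \<forall>\<alpha>. wt \<alpha> \<le> Q \<longrightarrow> mps_coeff f \<alpha> = 0}"

lemma wt_add: "wt (\<alpha> + \<beta>) = wt \<alpha> + wt \<beta>"
  by (simp add: wt_def)

lemma finite_wt_le: "finite {\<alpha> :: 'r::finite tvar multiset. wt \<alpha> \<le> Q}"
proof -
  have size: "size \<alpha> \<le> wt \<alpha>" for \<alpha> :: "'r tvar multiset"
    by (induction \<alpha>) (auto simp: wt_def)
  have elem: "Suc (snd x) \<le> wt \<alpha>" if "x \<in># \<alpha>" for x and \<alpha> :: "'r tvar multiset"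
    using that by (auto simp: wt_def dest!: multi_member_split)
  have "{\<alpha> :: 'r tvar multiset. wt \<alpha> \<le> Q}
      \<subseteq> mset ` {xs. set xs \<subseteq> UNIV \<times> {..Q} \<and> length xs \<le> Q}"
  proof
    fix \<alpha> :: "'r tvar multiset" assume "\<alpha> \<in> {\<alpha>. wt \<alpha> \<le> Q}"
    then have \<alpha>: "wt \<alpha> \<le> Q" by simp
    obtain xs where xs: "mset xs = \<alpha>" using ex_mset by blast
    have "set xs \<subseteq> UNIV \<times> {..Q}"
    proof
      fix x assume "x \<in> set xs"
      then have "Suc (snd x) \<le> Q" using elem[of x \<alpha>] \<alpha> xs by (metis le_trans set_mset_mset)
      then show "x \<in> UNIV \<times> {..Q}" by (cases x) simp
    qed
    moreover have "length xs \<le> Q" using size[of \<alpha>] \<alpha> xs by (metis le_trans size_mset)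
    ultimately show "\<alpha> \<in> mset ` {xs. set xs \<subseteq> UNIV \<times> {..Q} \<and> length xs \<le> Q}"
      using xs by blast
  qed
  then show ?thesis
    by (rule finite_subset) (auto intro!: finite_imageI finite_lists_length_le)
qed

lemma wt_ideal_zero [simp]: "0 \<in> wt_ideal Q"
  and wt_ideal_add: "f \<in> wt_ideal Q \<Longrightarrow> g \<in> wt_ideal Q \<Longrightarrow> f + g \<in> wt_ideal Q"
  and wt_ideal_diff: "f \<in> wt_ideal Q \<Longrightarrow> g \<in> wt_ideal Q \<Longrightarrow> f - g \<in> wt_ideal Q"
  by (simp_all add: wt_ideal_def)

lemma wt_ideal_sum: "(\<And>i. i \<in> A \<Longrightarrow> f i \<in> wt_ideal Q) \<Longrightarrow> sum f A \<in> wt_ideal Q"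
  by (induction A rule: infinite_finite_induct) (auto intro: wt_ideal_add)

lemma wt_ideal_mult_left: "f \<in> wt_ideal Q \<Longrightarrow> g * f \<in> wt_ideal Q"
  by (auto simp: wt_ideal_def mps_coeff_mult mem_msplits wt_add intro!: sum.neutral)

lemma wt_ideal_mult_right: "f \<in> wt_ideal Q \<Longrightarrow> f * g \<in> wt_ideal Q"
  by (metis mult.commute wt_ideal_mult_left)

text \<open>
  The weight of the lowest homogeneous part is additive under multiplication, because the product of
  the lowest parts is not zero.
\<close>

lemma wt_ideal_cancel:
  fixes f :: "'r::finite OJ"
  assumes "f \<noteq> 0"
  obtains w where "\<And>g Q. f * g \<in> wt_ideal (Q + w) \<Longrightarrow> g \<in> wt_ideal Q"
proof -
  have lowest: "\<exists>\<alpha>. mps_coeff h \<alpha> \<noteq> 0 \<and> (\<forall>\<beta>. mps_coeff h \<beta> \<noteq> 0 \<longrightarrow> wt \<alpha> \<le> wt \<beta>)"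
    if "h \<noteq> 0" for h :: "'r OJ"
  proof -
    from mps_nonzero[OF that] obtain \<alpha> where "mps_coeff h \<alpha> \<noteq> 0" ..
    from ex_has_least_nat[of "\<lambda>\<alpha>. mps_coeff h \<alpha> \<noteq> 0", OF this] show ?thesis by blast
  qed
  define part where "part w h = Abs_mps (\<lambda>\<alpha>. if wt \<alpha> = w then mps_coeff h \<alpha> else 0)"
    for w and h :: "'r OJ"
  obtain \<alpha> where \<alpha>: "mps_coeff f \<alpha> \<noteq> 0" "\<And>\<beta>. mps_coeff f \<beta> \<noteq> 0 \<Longrightarrow> wt \<alpha> \<le> wt \<beta>"
    using lowest[OF assms] by blast
  have "g \<in> wt_ideal Q" if fg: "f * g \<in> wt_ideal (Q + wt \<alpha>)" for g Q
  proof (rule ccontr)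
    assume notin: "g \<notin> wt_ideal Q"
    then have "g \<noteq> 0" by auto
    then obtain \<beta> where \<beta>: "mps_coeff g \<beta> \<noteq> 0" "\<And>\<gamma>. mps_coeff g \<gamma> \<noteq> 0 \<Longrightarrow> wt \<beta> \<le> wt \<gamma>"
      using lowest by blast
    have "wt \<beta> \<le> Q" using notin \<beta>(2) by (auto simp: wt_ideal_def intro: le_trans)
    have "mps_coeff (part (wt \<alpha>) f) \<alpha> \<noteq> 0" "mps_coeff (part (wt \<beta>) g) \<beta> \<noteq> 0"
      using \<alpha>(1) \<beta>(1) by (simp_all add: part_def)
    then have "part (wt \<alpha>) f \<noteq> 0" "part (wt \<beta>) g \<noteq> 0" by auto
    then have "part (wt \<alpha>) f * part (wt \<beta>) g \<noteq> 0" by simp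
    from mps_nonzero[OF this] obtain \<gamma>
      where \<gamma>: "mps_coeff (part (wt \<alpha>) f * part (wt \<beta>) g) \<gamma> \<noteq> 0" ..
    obtain p where "p \<in> msplits \<gamma>"
      "(case p of (\<delta>, \<epsilon>) \<Rightarrow> mps_coeff (part (wt \<alpha>) f) \<delta> * mps_coeff (part (wt \<beta>) g) \<epsilon>) \<noteq> 0"
      using \<gamma> unfolding mps_coeff_mult by (rule sum.not_neutral_contains_not_neutral)
    then have wt\<gamma>: "wt \<gamma> = wt \<alpha> + wt \<beta>"
      by (cases p) (auto simp: mem_msplits part_def wt_add split: if_splits)
    have eq: "mps_coeff (part (wt \<alpha>) f) \<delta> * mps_coeff (part (wt \<beta>) g) \<epsilon> = mps_coeff f \<delta> * mps_coeff g \<epsilon>"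
      if "(\<delta>, \<epsilon>) \<in> msplits \<gamma>" for \<delta> \<epsilon>
    proof (cases "mps_coeff f \<delta> = 0 \<or> mps_coeff g \<epsilon> = 0")
      case False
      then have "wt \<alpha> \<le> wt \<delta>" "wt \<beta> \<le> wt \<epsilon>" using \<alpha>(2) \<beta>(2) by auto
      moreover have "wt \<delta> + wt \<epsilon> = wt \<alpha> + wt \<beta>" using that wt\<gamma> by (auto simp: mem_msplits wt_add)
      ultimately show ?thesis by (simp add: part_def)
    qed (auto simp: part_def)
    have "mps_coeff (part (wt \<alpha>) f * part (wt \<beta>) g) \<gamma> = mps_coeff (f * g) \<gamma>"
      unfolding mps_coeff_mult by (rule sum.cong) (use eq in auto)
    moreover have "mps_coeff (f * g) \<gamma> = 0"
      using fg wt\<gamma> \<open>wt \<beta> \<le> Q\<close> by (simp add: wt_ideal_def)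
    ultimately show False using \<gamma> by simp
  qed
  then show thesis by (rule that)
qed

section \<open>Cramer's rule\<close>

text \<open>
  The Leibniz formula is transported along an enumeration of \<open>S\<close>, which makes the adjugate of a matrix
  indexed by numbers available.
\<close>

lemma det_on_eq_det:
  fixes M :: "'i \<Rightarrow> 'i \<Rightarrow> 'a::comm_ring_1"
  assumes b: "bij_betw b {0..<n} S"
  shows "det_on S M = det (mat n n (\<lambda>(i, j). M (b i) (b j)))"
proof -
  have S: "S = b ` {0..<n}" and inj: "inj_on b {0..<n}" using b by (auto simp: bij_betw_def)
  let ?\<Phi> = "map_permutation {0..<n} b"
  have inv: "bij_betw (inv_into {0..<n} b) S {0..<n}" using b by (rule bij_betw_inv_into)
  have "det_on S M = (\<Sum>p | p permutes {0..<n}. of_int (sign (?\<Phi> p)) * (\<Prod>i\<in>S. M i (?\<Phi> p i)))"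
    unfolding det_on_def
  proof (rule sum.reindex_bij_witness[where i = "?\<Phi>" and j = "map_permutation S (inv_into {0..<n} b)"])
    fix p assume "p \<in> {p. p permutes S}"
    then have p: "p permutes S" by simp
    show "?\<Phi> (map_permutation S (inv_into {0..<n} b) p) = p"
      by (rule map_permutation_compose_inv[OF inv p]) (use b in \<open>simp add: bij_betw_inv_into_right\<close>)
    show "map_permutation S (inv_into {0..<n} b) p \<in> {p. p permutes {0..<n}}"
      using map_permutation_permutes[OF inv p] by simp
    then show "of_int (sign (?\<Phi> (map_permutation S (inv_into {0..<n} b) p)))
        * (\<Prod>i\<in>S. M i (?\<Phi> (map_permutation S (inv_into {0..<n} b) p) i))
      = of_int (sign p) * (\<Prod>i\<in>S. M i (p i))"
      using \<open>?\<Phi> (map_permutation S (inv_into {0..<n} b) p) = p\<close> by simp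
  next
    fix p assume "p \<in> {p. p permutes {0..<n}}"
    then have p: "p permutes {0..<n}" by simp
    show "map_permutation S (inv_into {0..<n} b) (?\<Phi> p) = p"
      by (rule map_permutation_compose_inv[OF b p]) (use b in \<open>simp add: bij_betw_inv_into_left\<close>)
    show "?\<Phi> p \<in> {p. p permutes S}"
      using map_permutation_permutes[OF b p] by simp
  qed
  also have "\<dots> = (\<Sum>p | p permutes {0..<n}. of_int (sign p) * (\<Prod>i\<in>{0..<n}. M (b i) (b (p i))))"
  proof (rule sum.cong)
    fix p assume "p \<in> {p. p permutes {0..<n}}"
    then have p: "p permutes {0..<n}" by simp
    have "(\<Prod>i\<in>S. M i (?\<Phi> p i)) = (\<Prod>i\<in>{0..<n}. M (b i) (?\<Phi> p (b i)))"
      unfolding S by (rule prod.reindex[OF inj, simplified o_def])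
    also have "\<dots> = (\<Prod>i\<in>{0..<n}. M (b i) (b (p i)))"
      by (rule prod.cong) (simp_all add: map_permutation_apply inj)
    finally show "of_int (sign (?\<Phi> p)) * (\<Prod>i\<in>S. M i (?\<Phi> p i))
        = of_int (sign p) * (\<Prod>i\<in>{0..<n}. M (b i) (b (p i)))"
      using sign_map_permutation[OF inj p] by simp
  qed simp
  also have "\<dots> = det (mat n n (\<lambda>(i, j). M (b i) (b j)))"
    by (auto simp: det_def permutes_in_image intro!: sum.cong prod.cong)
  finally show ?thesis .
qed

text \<open>
  The solution is the adjugate matrix applied to \<open>l\<close>; it exists over every commutative ring, whether
  or not the determinant is invertible or even nonzero.
\<close>

lemma det_on_solve:
  fixes M :: "'i \<Rightarrow> 'i \<Rightarrow> 'a::comm_ring_1"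
  assumes "finite S"
  obtains f where "\<And>a. a \<in> S \<Longrightarrow> (\<Sum>b\<in>S. M a b * f b) = det_on S M * l a"
proof -
  obtain b where b: "bij_betw b {0..<card S} S"
    using ex_bij_betw_nat_finite[OF assms] by blast
  define n where "n = card S"
  define A where "A = mat n n (\<lambda>(i, j). M (b i) (b j))"
  define u where "u = vec n (\<lambda>i. l (b i))"
  define x where "x = adj_mat A *\<^sub>v u"
  have A: "A \<in> carrier_mat n n" and u: "u \<in> carrier_vec n" by (simp_all add: A_def u_def)
  note adj = adj_mat[OF A]
  have x: "x \<in> carrier_vec n" using adj(1) by (simp add: x_def mult_mat_vec_def)
  have Ax: "A *\<^sub>v x = det A \<cdot>\<^sub>v u"
    unfolding x_def assoc_mult_mat_vec[OF A adj(1) u, symmetric] adj(2)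
    using u by auto
  define c where "c = inv_into {0..<n} b"
  have bn: "bij_betw b {0..<n} S" using b by (simp add: n_def)
  have cb: "c (b i) = i" if "i < n" for i
    using bij_betw_inv_into_left[OF bn, of i] that by (simp add: c_def)
  have "(\<Sum>s\<in>S. M a s * (x $ c s)) = det_on S M * l a" if "a \<in> S" for a
  proof -
    have "a \<in> b ` {0..<n}" using that bij_betw_imp_surj_on[OF bn] by blast
    then obtain i where i: "i < n" "a = b i" by auto
    have "(\<Sum>s\<in>S. M a s * (x $ c s)) = (\<Sum>j\<in>{0..<n}. M (b i) (b j) * (x $ j))"
      unfolding i(2) sum.reindex_bij_betw[OF bn, of "\<lambda>s. M (b i) s * (x $ c s)", symmetric]
      by (rule sum.cong) (simp_all add: cb)
    also have "\<dots> = (A *\<^sub>v x) $ i"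
      using i x by (simp add: A_def scalar_prod_def)
    also have "\<dots> = det A * l a" using i u by (simp add: Ax u_def)
    finally show ?thesis by (simp add: det_on_eq_det[OF bn] A_def)
  qed
  then show thesis by (rule that[where f = "\<lambda>s. x $ c s"])
qed

section \<open>Linear algebra in \<open>V\<close>\<close>

abbreviation V_functional :: "('r V \<Rightarrow> complex) \<Rightarrow> bool" where
  "V_functional \<equiv> module_hom V_scale (*)"

lemma V_functionalI:
  assumes "\<And>x y. \<phi> (x + y) = \<phi> x + \<phi> y" "\<And>c x. \<phi> (V_scale c x) = c * \<phi> x"
  shows "V_functional \<phi>"
proof -
  have "Modules.module ((*) :: complex \<Rightarrow> complex \<Rightarrow> complex)"
    by unfold_locales (simp_all add: algebra_simps)
  then show ?thesis using assms V.module_axioms by (simp add: module_hom_iff)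
qed

text \<open>The coordinate of \<open>x\<close> in a basis that contains \<open>x\<close> and a basis of \<open>T\<close>.\<close>

lemma exists_separating_functional:
  assumes T: "V.subspace T" and x: "x \<notin> T"
  obtains \<phi> where "V_functional \<phi>" "\<And>y. y \<in> T \<Longrightarrow> \<phi> y = 0" "\<phi> x = 1"
proof -
  obtain B where B: "B \<subseteq> T" "V.independent B" "T \<subseteq> V.span B"
    by (rule V.maximal_independent_subset)
  have spanB: "V.span B = T" using B T by (metis V.span_minimal subset_antisym)
  then have xB: "x \<notin> V.span B" "x \<notin> B" using x B by auto
  then have "V.independent (insert x B)" using B by (simp add: V.independent_insertI)
  then obtain B' where B': "insert x B \<subseteq> B'" "V.independent B'" "UNIV \<subseteq> V.span B'"
    by (metis V.maximal_independent_subset_extend subset_UNIV)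
  define \<phi> where "\<phi> y = V.representation B' y x" for y
  show thesis
  proof (rule that)
    show "V_functional \<phi>"
      using B' by (intro V_functionalI)
        (auto simp: \<phi>_def V.representation_add V.representation_scale subset_iff)
    show "\<phi> y = 0" if "y \<in> T" for y
    proof -
      have "V.representation B' y = V.representation B y"
        by (rule V.representation_extend) (use B' that spanB in auto)
      then show ?thesis using xB V.representation_ne_zero[of B y x] by (auto simp: \<phi>_def)
    qed
    show "\<phi> x = 1"
      using B' by (simp add: \<phi>_def V.representation_basis)
  qed
qed

lemma span_Un_subspaces:
  assumes "V.subspace S" "V.subspace T" "x \<in> V.span (S \<union> T)"
  shows "\<exists>u v. x = u + v \<and> u \<in> S \<and> v \<in> T"
proof -
  have *: "V.span S = S" "V.span T = T" using assms by simp_all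
  show ?thesis using assms(3) unfolding V.span_Un * by blast
qed

lemma V_filt_subspace: "V.subspace (V_filt K)"
  by (simp add: V.subspace_def V_filt_def V_scale_def)

lemma V_filt_mono: "K \<le> K' \<Longrightarrow> V_filt K' \<subseteq> V_filt K"
  by (auto simp: V_filt_def)

lemma V_filt_Inter: 
  assumes "\<And>K :: nat. x \<in> V_filt (int K)" shows "x = 0"
proof (rule ext)
  fix i
  show "x i = 0 i"
  proof (rule fls_eqI)
    fix l
    have "l < int (nat (l + 1))" by simp
    then show "fls_nth (x i) l = fls_nth (0 i) l"
      using assms[of "nat (l + 1)"] by (simp add: V_filt_def)
  qed
qed

text \<open>
  The filtration has zero intersection, and the dimension of \<open>W \<inter> V_filt K\<close> cannot drop below its
  minimum, so this intersection is zero where the minimum is attained.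
\<close>

lemma finite_dim_Int_V_filt:
  assumes W: "V.subspace W" "W \<subseteq> V.span B" "finite B"
  obtains K :: nat where "W \<inter> V_filt (int K) = {0}"
proof -
  define P where "P n \<longleftrightarrow> (\<exists>K :: nat. \<exists>S. V.independent S \<and> S \<subseteq> W \<inter> V_filt (int K) \<and>
    W \<inter> V_filt (int K) \<subseteq> V.span S \<and> card S = n)" for n
  have basis: "\<exists>S. V.independent S \<and> S \<subseteq> W \<inter> V_filt K \<and> W \<inter> V_filt K \<subseteq> V.span S" for K
    by (meson V.maximal_independent_subset)
  have fin: "finite S" if "V.independent S" "S \<subseteq> W \<inter> V_filt K" for S K
    using V.independent_span_bound[OF W(3) that(1)] that(2) W(2) by blast
  have "\<exists>n. P n" using basis[of "int 0"] unfolding P_def by metis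
  then have "P (LEAST n. P n)" by (rule LeastI_ex)
  then obtain K :: nat and S where S: "V.independent S" "S \<subseteq> W \<inter> V_filt (int K)"
    "W \<inter> V_filt (int K) \<subseteq> V.span S" "card S = (LEAST n. P n)" unfolding P_def by blast
  have "W \<inter> V_filt (int K) \<subseteq> V_filt (int K')" for K' :: nat
  proof (cases "K \<le> K'")
    case True
    obtain S' where S': "V.independent S'" "S' \<subseteq> W \<inter> V_filt (int K')"
      "W \<inter> V_filt (int K') \<subseteq> V.span S'" using basis by blast
    have sub: "W \<inter> V_filt (int K') \<subseteq> W \<inter> V_filt (int K)"
      using True V_filt_mono[of "int K" "int K'"] by auto
    have "P (card S')" using S' unfolding P_def by blast
    then have "card S \<le> card S'" unfolding S(4) by (rule Least_le)
    have sp': "V.span S' \<subseteq> W \<inter> V_filt (int K')"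
      using S'(2) W(1) V_filt_subspace by (intro V.span_minimal V.subspace_inter)
    show ?thesis
    proof
      fix s assume s: "s \<in> W \<inter> V_filt (int K)"
      show "s \<in> V_filt (int K')"
      proof (rule ccontr)
        assume "s \<notin> V_filt (int K')"
        then have "s \<notin> V.span S'" "s \<notin> S'" using sp' S' by auto
        then have "V.independent (insert s S')" using S'(1) by (simp add: V.independent_insertI)
        moreover have "insert s S' \<subseteq> V.span S" using s S(3) S'(2) sub by auto
        ultimately have "card (insert s S') \<le> card S"
          using V.independent_span_bound[OF fin[OF S(1,2)]] by blast
        then show False
          using \<open>card S \<le> card S'\<close> \<open>s \<notin> S'\<close> fin[OF S'(1,2)] by simp
      qed
    qed
  next
    case False
    then show ?thesis using V_filt_mono[of "int K'" "int K"] by auto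
  qed
  then have "W \<inter> V_filt (int K) \<subseteq> {0}" using V_filt_Inter by blast
  moreover have "0 \<in> W \<inter> V_filt (int K)" using W(1) V_filt_subspace V.subspace_0 by blast
  ultimately show thesis using that[of K] by blast
qed

section \<open>The index of points of the Grassmannian\<close>

text \<open>
  In \<open>V / W\<close> the set \<open>D\<close> stays independent and \<open>C\<close> generates.  The quotient is replaced by the projections
  of \<open>V\<close> that kill \<open>W\<close> onto the spans of the finite subsets of \<open>D\<close>.
\<close>

lemma card_le_of_span_complement:
  assumes D: "V.independent D" "V.span D \<inter> W = {0}" and W: "V.subspace W"
    and C: "finite C" "V.span (C \<union> W) = UNIV"
  shows "finite D \<and> card D \<le> card C"
proof -
  obtain B where B: "B \<subseteq> W" "V.independent B" "W \<subseteq> V.span B"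
    by (rule V.maximal_independent_subset)
  have spanB: "V.span B = W" using B W by (metis V.span_minimal subset_antisym)
  have ind: "V.independent (D' \<union> B)" if "finite D'" "D' \<subseteq> D" for D'
    using that
  proof (induction D' rule: finite_induct)
    case (insert d D')
    have "d \<notin> V.span (D' \<union> B)"
    proof
      assume "d \<in> V.span (D' \<union> B)"
      then obtain a b where ab: "d = a + b" "a \<in> V.span D'" "b \<in> W"
        unfolding V.span_Un spanB by auto
      then have "b = d - a" by simp
      moreover have "d \<in> V.span D" "a \<in> V.span D"
        using insert.prems ab(2) V.span_mono[of D' D] by (auto intro: V.span_base)
      ultimately have "b = 0" using D(2) ab(3) V.span_diff by blast
      then have "d \<in> V.span D'" using ab by simp
      moreover have "D' \<subseteq> D - {d}" using insert by auto
      ultimately have "d \<in> V.span (D - {d})" using V.span_mono by blast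
      then show False using D(1) insert.prems by (auto simp: V.dependent_def)
    qed
    then show ?case using insert by (simp add: V.independent_insertI)
  qed (use B in simp)
  have bound: "card D' \<le> card C" if D': "finite D'" "D' \<subseteq> D" for D'
  proof -
    obtain B' where B': "D' \<union> B \<subseteq> B'" "V.independent B'" "UNIV \<subseteq> V.span B'"
      by (metis V.maximal_independent_subset_extend[OF subset_UNIV ind[OF D']])
    \<comment> \<open>The projection to the span of \<open>D'\<close> that kills \<open>W\<close>.\<close>
    define \<pi> where "\<pi> v = (\<Sum>d\<in>D'. V_scale (V.representation B' v d) d)" for v
    have disj: "d \<notin> B" if "d \<in> D'" for d
    proof
      assume "d \<in> B"
      then have "d \<in> V.span D \<inter> W" using B that D' by (auto intro: V.span_base)
      then show False using D that D' V.dependent_zero by auto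
    qed
    have add: "\<pi> (x + y) = \<pi> x + \<pi> y" for x y
      using B' by (auto simp: \<pi>_def V.representation_add subset_iff V.scale_left_distrib sum.distrib)
    have scale: "\<pi> (V_scale c x) = V_scale c (\<pi> x)" for c x
      using B' by (auto simp: \<pi>_def V.representation_scale subset_iff V.scale_sum_right)
    have \<pi>W: "\<pi> w = 0" if "w \<in> W" for w
    proof -
      have "V.representation B' w = V.representation B w"
        by (rule V.representation_extend) (use B' that spanB in auto)
      then have "V.representation B' w d = 0" if "d \<in> D'" for d
        using disj[OF that] V.representation_ne_zero[of B w d] by auto
      then show ?thesis by (simp add: \<pi>_def)
    qed
    have \<pi>D: "\<pi> d = d" if "d \<in> D'" for d
    proof -
      have "\<pi> d = (\<Sum>d'\<in>D'. if d' = d then d else 0)"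
        unfolding \<pi>_def
        by (rule sum.cong) (use B' that in \<open>auto simp: V.representation_basis\<close>)
      then show ?thesis using D' that by simp
    qed
    have "\<pi> x \<in> V.span (\<pi> ` C)" if "x \<in> V.span (C \<union> W)" for x
      using that
    proof (induction rule: V.span_induct_alt)
      case base
      have "\<pi> 0 = 0" using scale[of 0 0] by simp
      then show ?case by (metis V.span_zero)
    next
      case (step c x y)
      have "\<pi> x \<in> V.span (\<pi> ` C)" using step(1) \<pi>W by (auto intro: V.span_base V.span_zero)
      then show ?case using step(2) unfolding add scale by (intro V.span_add V.span_scale)
    qed
    then have "D' \<subseteq> V.span (\<pi> ` C)" using \<pi>D C(2) by (metis UNIV_I subsetI)
    moreover have "V.independent D'" using D(1) D' V.dependent_mono by blast
    ultimately have "card D' \<le> card (\<pi> ` C)"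
      using V.independent_span_bound[of "\<pi> ` C" D'] C(1) by simp
    then show ?thesis using card_image_le[OF C(1), of \<pi>] by simp
  qed
  have "finite D"
  proof (rule ccontr)
    assume "infinite D"
    then obtain D' where "finite D'" "card D' = Suc (card C)" "D' \<subseteq> D"
      using infinite_arbitrarily_large by blast
    then show False using bound[of D'] by simp
  qed
  then show ?thesis using bound[of D] by simp
qed

text \<open>
  Enlarging \<open>U\<close> cannot shrink the kernel of \<open>U \<rightarrow> V / V_plus\<close> and cannot enlarge its cokernel, so
  two nested points of the same index have the same kernel and the same cokernel.
\<close>

lemma Gr_subset_imp_eq:
  assumes U: "U \<in> Gr m" and U': "U' \<in> Gr m" and sub: "U \<subseteq> U'"
  shows "U = U'"
proof (rule subset_antisym[OF sub], rule subsetI)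
  obtain B C where BC: "finite B" "V.independent B" "V.span B = U \<inter> V_plus"
    "finite C" "V.span (C \<union> U \<union> V_plus) = UNIV" "m = int (card B) - int (card C)"
    and sU: "V.subspace U"
    using U unfolding Gr_def by blast
  obtain B' C' where BC': "finite B'" "V.independent B'" "V.span B' = U' \<inter> V_plus"
    "finite C'" "V.independent C'" "V.span C' \<inter> V.span (U' \<union> V_plus) = {0}"
    "m = int (card B') - int (card C')" and sU': "V.subspace U'"
    using U' unfolding Gr_def by blast
  let ?W = "V.span (U \<union> V_plus)"
  have W': "?W \<subseteq> V.span (U' \<union> V_plus)" using sub by (intro V.span_mono) auto
  have CW: "V.span (C \<union> ?W) = UNIV"
  proof -
    have "C \<union> U \<union> V_plus \<subseteq> C \<union> ?W" using V.span_superset by blast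
    then show ?thesis using V.span_mono BC(5) by blast
  qed
  have BB': "card B \<le> card B'" if "B \<subseteq> V.span B'"
    using V.independent_span_bound[OF BC'(1) BC(2) that] by simp
  have Bspan: "B \<subseteq> V.span B'" using BC(3) BC'(3) sub V.span_superset by blast
  have "V.span C' \<inter> ?W \<subseteq> {0}" using BC'(6) W' by blast
  then have C'W: "V.span C' \<inter> ?W = {0}" using V.span_zero by blast
  have CC': "card C' \<le> card C"
    using card_le_of_span_complement[OF BC'(5) C'W V.subspace_span BC(4) CW] by simp
  have ker: "U' \<inter> V_plus \<subseteq> U"
  proof (rule ccontr)
    assume "\<not> U' \<inter> V_plus \<subseteq> U"
    then obtain b where b: "b \<in> U'" "b \<in> V_plus" "b \<notin> U" by blast
    then have nb: "b \<notin> V.span B" "b \<notin> B" using BC(3) V.span_base by blast+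
    have "V.independent (insert b B)" using nb BC(2) by (simp add: V.independent_insertI)
    moreover have "insert b B \<subseteq> V.span B'" using b BC'(3) Bspan by auto
    ultimately have "card (insert b B) \<le> card B'"
      using V.independent_span_bound[OF BC'(1)] by blast
    then show False using nb BC(1,6) BC'(7) CC' by simp
  qed
  fix x assume x: "x \<in> U'"
  have "x \<in> ?W"
  proof (rule ccontr)
    assume xW: "x \<notin> ?W"
    have xW': "x \<in> V.span (U' \<union> V_plus)" using x by (simp add: V.span_base)
    have xC: "x \<notin> V.span C'"
    proof
      assume "x \<in> V.span C'"
      then have "x = 0" using xW' BC'(6) by blast
      then show False using xW V.span_zero by blast
    qed
    then have "V.independent (insert x C')" using BC'(5) by (simp add: V.independent_insertI)
    moreover have "V.span (insert x C') \<inter> ?W \<subseteq> {0}"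
    proof
      fix y assume y: "y \<in> V.span (insert x C') \<inter> ?W"
      then obtain k where k: "y - V_scale k x \<in> V.span C'" by (auto simp: V.span_insert)
      have "y - V_scale k x \<in> V.span (U' \<union> V_plus)"
        using y W' xW' by (intro V.span_diff V.span_scale) auto
      then have "y - V_scale k x \<in> {0}" using k unfolding BC'(6)[symmetric] by simp
      then have eq: "y = V_scale k x" by simp
      have "k = 0"
      proof (rule ccontr)
        assume "k \<noteq> 0"
        then have "x = V_scale (1 / k) y" by (simp add: eq)
        then show False using y xW V.span_scale by auto
      qed
      then show "y \<in> {0}" by (simp add: eq)
    qed
    then have "V.span (insert x C') \<inter> ?W = {0}" using V.span_zero by blast
    ultimately have "card (insert x C') \<le> card C"
      using card_le_of_span_complement[OF _ _ V.subspace_span BC(4) CW] by blast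
    moreover have "x \<notin> C'" using xC V.span_base by blast
    ultimately show False using BC'(4,7) BC(6) BB'[OF Bspan] by simp
  qed
  then obtain u v where uv: "x = u + v" "u \<in> U" "v \<in> V_plus"
    using span_Un_subspaces[OF sU V_filt_subspace] by blast
  then have "v = x - u" by simp
  then have "v \<in> U'" using V.subspace_diff[OF sU' x] uv(2) sub by auto
  then have "v \<in> U" using ker uv by blast
  then show "x \<in> U" using uv sU by (auto intro: V.subspace_add)
qed

section \<open>The pairing\<close>

text \<open>
  Multiplication by \<open>z_i^k\<close> has on \<open>V_i\<close> the trace \<open>e_i z^l\<close> if \<open>k = e_i l\<close> and the trace zero if \<open>e_i\<close> does
  not divide \<open>k\<close>; the residue picks the term with \<open>l = -1\<close>.
\<close>

lemma T2_eq:
  assumes e: "\<And>i. e i > 0"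
  shows "T2 e a b = (\<Sum>i\<in>UNIV. of_nat (e i) * fls_nth ((a * b) i) (- int (e i)))"
proof -
  have coord: "fls_nth (coord d k f) (-1) = fls_nth f (int k - int d)" if "d > 0" "k < d" for d k f
  proof -
    have "\<exists>N. \<forall>n<N. fls_nth f (int d * n + int k) = 0"
    proof (intro exI allI impI)
      fix n assume n: "n < min (fls_subdegree f) 0 - 1"
      have "int d * n + int k \<le> int d * (n + 1)" using that by (simp add: algebra_simps)
      also have "\<dots> \<le> 1 * (n + 1)" using n that by (intro mult_right_mono_neg) auto
      finally show "fls_nth f (int d * n + int k) = 0" using n by simp
    qed
    from nth_Abs_fls_ex_lower_bound[OF this] show ?thesis by (simp add: coord_def)
  qed
  have "T2 e a b = (\<Sum>i\<in>UNIV. \<Sum>k<e i. fls_nth ((a * b) i) (- int (e i)))"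
    using e by (auto simp: T2_def Tr_def fls_nth_sum coord zsingle_def
        fls_X_intpow_times_conv_shift intro!: sum.cong)
  then show ?thesis by simp
qed

lemma T2_commute: "T2 e a b = T2 e b a"
  by (simp add: T2_def mult.commute)

lemma V_functional_T2_left:
  assumes "\<And>i. e i > 0"
  shows "V_functional (\<lambda>a. T2 e a b)"
proof (rule V_functionalI)
  show "T2 e (x + y) b = T2 e x b + T2 e y b" for x y
    by (simp add: T2_eq[OF assms] distrib_right distrib_left sum.distrib)
  show "T2 e (V_scale c x) b = c * T2 e x b" for c x
    by (simp add: T2_eq[OF assms] V_scale_def mult.assoc sum_distrib_left)
      (simp add: mult.left_commute)
qed

lemma V_functional_T2_right:
  assumes "\<And>i. e i > 0"
  shows "V_functional (T2 e a)"
proof -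
  have "T2 e a = (\<lambda>b. T2 e b a)" by (rule ext) (rule T2_commute)
  then show ?thesis using V_functional_T2_left[where e = e, OF assms, of a] by simp
qed

lemma V_sum_apply: "(\<Sum>i\<in>A. f i) j = (\<Sum>i\<in>A. f i j)" for f :: "'a \<Rightarrow> 'r V"
  by (induction A rule: infinite_finite_induct) simp_all

text \<open>
  A functional that vanishes on some \<open>V_filt K\<close> is determined by its values on the \<open>zsingle j k\<close> with
  \<open>k < K\<close>.  These values prescribe the coefficients of \<open>y\<close>, and the bound on \<open>k\<close> makes \<open>y\<close> a family of
  Laurent series.
\<close>

lemma functional_represented_by_T2:
  fixes \<phi> :: "'r::finite V \<Rightarrow> complex"
  assumes e: "\<And>i. e i > 0" and \<phi>: "V_functional \<phi>" and K: "\<And>f. f \<in> V_filt K \<Longrightarrow> \<phi> f = 0"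
  obtains y where "\<And>f. \<phi> f = T2 e f y"
proof -
  define c where "c i l = \<phi> (zsingle i (- int (e i) - l)) / of_nat (e i)" for i l
  define y where "y = (\<lambda>i. Abs_fls (c i))"
  have c0: "c i l = 0" if "l < 1 - int (e i) - K" for i l
    using that K[of "zsingle i (- int (e i) - l)"] by (auto simp: c_def V_filt_def zsingle_def)
  have y: "fls_nth (y i) l = c i l" for i l
    unfolding y_def using c0 by (intro nth_Abs_fls_ex_lower_bound exI[of _ "1 - int (e i) - K"]) auto
  have T2_single: "T2 e (zsingle j k) y = \<phi> (zsingle j k)" for j k
  proof -
    have "T2 e (zsingle j k) y = (\<Sum>i\<in>UNIV. if i = j then \<phi> (zsingle j k) else 0)"
      unfolding T2_eq[OF e] using e[THEN less_imp_neq]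
      by (intro sum.cong) (auto simp: zsingle_def fls_X_intpow_times_conv_shift y c_def)
    then show ?thesis by simp
  qed
  have T2_K: "T2 e f y = 0" if "f \<in> V_filt K" for f
  proof -
    have "fls_nth (f i * y i) (- int (e i)) = 0" for i
    proof (cases "f i = 0 \<or> y i = 0")
      case False
      then have "K \<le> fls_subdegree (f i)" "1 - int (e i) - K \<le> fls_subdegree (y i)"
        using that by (auto intro!: fls_subdegree_geI simp: V_filt_def y c0)
      then show ?thesis by (intro fls_times_nth_eq0) simp
    qed auto
    then show ?thesis by (simp add: T2_eq[OF e])
  qed
  interpret \<phi>: module_hom V_scale "(*)" \<phi> by fact
  interpret T: module_hom V_scale "(*)" "\<lambda>f. T2 e f y" by (rule V_functional_T2_left[OF e])
  have "\<phi> f = T2 e f y" for f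
  proof -
    define d where "d = Min (range (\<lambda>i. fls_subdegree (f i)))"
    define h where "h = (\<Sum>i\<in>UNIV. \<Sum>k\<in>{d..<K}. V_scale (fls_nth (f i) k) (zsingle i k))"
    have "f - h \<in> V_filt K"
    proof -
      have nth_h: "fls_nth (h j) l = (if d \<le> l \<and> l < K then fls_nth (f j) l else 0)" for j l
      proof -
        have "h j = (\<Sum>i\<in>UNIV. if i = j
            then \<Sum>k\<in>{d..<K}. fls_const (fls_nth (f j) k) * fls_X_intpow k else 0)"
          unfolding h_def V_sum_apply
          by (intro sum.cong) (auto simp: V_scale_def zsingle_def)
        then have "h j = (\<Sum>k\<in>{d..<K}. fls_const (fls_nth (f j) k) * fls_X_intpow k)" by simp
        then have "fls_nth (h j) l = (\<Sum>k\<in>{d..<K}. if k = l then fls_nth (f j) l else 0)"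
          by (simp only: fls_nth_sum, intro sum.cong) auto
        then show ?thesis by simp
      qed
      have "fls_nth (f j) l = 0" if "l < d" for j l
      proof -
        have "d \<le> fls_subdegree (f j)" unfolding d_def by (rule Min_le) auto
        then show ?thesis using that by simp
      qed
      then show ?thesis by (auto simp: V_filt_def nth_h)
    qed
    then have "\<phi> f = \<phi> h" "T2 e f y = T2 e h y"
      using K[of "f - h"] T2_K[of "f - h"] by (simp_all add: \<phi>.diff T.diff)
    moreover have "\<phi> h = T2 e h y"
      unfolding h_def \<phi>.sum T.sum \<phi>.scale T.scale T2_single ..
    ultimately show ?thesis by simp
  qed
  then show thesis by (rule that)
qed

text \<open>
  This is \<open>U\<^sup>\<bottom>\<^sup>\<bottom> \<subseteq> U\<close>.  The point \<open>U\<close> is closed in the topology of \<open>V\<close> defined by the \<open>V_filt K\<close>, because it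
  is discrete, so some functional vanishes on \<open>U\<close> and on some \<open>V_filt K\<close> but not at \<open>x\<close>; being
  continuous, it is given by the pairing.
\<close>

lemma orth_separates_Gr:
  fixes U :: "'r::finite V set"
  assumes e: "\<And>i. e i > 0" and U: "U \<in> Gr m" and x: "x \<notin> U"
  obtains y where "y \<in> orth e U" "T2 e x y \<noteq> 0"
proof -
  obtain B where sU: "V.subspace U" and B: "finite B" "V.span B = U \<inter> V_plus"
    using U unfolding Gr_def by blast
  obtain K0 :: nat where K0: "(U \<inter> V_plus) \<inter> V_filt (int K0) = {0}"
    by (rule finite_dim_Int_V_filt[of "U \<inter> V_plus" B])
      (use B sU V_filt_subspace in \<open>auto intro: V.subspace_inter\<close>)
  have UK: "u = 0" if "u \<in> U" "u \<in> V_filt (int K)" "K0 \<le> K" for u K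
    using that K0 V_filt_mono[of 0 "int K"] V_filt_mono[of "int K0" "int K"] by auto
  (* Otherwise the components in U of the decompositions of x agree for all large K. *)
  have "\<exists>K :: nat. x \<notin> V.span (U \<union> V_filt (int K))"
  proof (rule ccontr)
    assume "\<not> ?thesis"
    then have "\<exists>u v. x = u + v \<and> u \<in> U \<and> v \<in> V_filt (int K)" for K :: nat
      using span_Un_subspaces[OF sU V_filt_subspace] by blast
    then obtain u v where uv: "x = u K + v K" "u K \<in> U" "v K \<in> V_filt (int K)" for K :: nat
      by metis
    have const: "u K = u K0" if "K0 \<le> K" for K
    proof -
      have "u K - u K0 = v K0 - v K" using uv(1)[of K] uv(1)[of K0] by (simp add: algebra_simps)
      moreover have "v K \<in> V_filt (int K0)" using uv(3)[of K] V_filt_mono[of "int K0" "int K"] that by auto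
      ultimately have "u K - u K0 \<in> V_filt (int K0)"
        using V.subspace_diff[OF V_filt_subspace uv(3)[of K0]] by simp
      then have "u K - u K0 = 0"
        using UK[of "u K - u K0" K0] V.subspace_diff[OF sU uv(2) uv(2)] by blast
      then show ?thesis by simp
    qed
    have "u (max K K0) = u K0" for K by (rule const) simp
    then have "x - u K0 = v (max K K0)" for K
      using uv(1)[of "max K K0"] by (metis add_diff_cancel_left')
    then have "x - u K0 \<in> V_filt (int K)" for K :: nat
      using uv(3)[of "max K K0"] V_filt_mono[of "int K" "int (max K K0)"] by auto
    then have "x - u K0 = 0" by (rule V_filt_Inter)
    then show False using x uv(2)[of K0] by simp
  qed
  then obtain K :: nat where K: "x \<notin> V.span (U \<union> V_filt (int K))" by blast
  obtain \<phi> where \<phi>: "V_functional \<phi>" "\<And>f. f \<in> V.span (U \<union> V_filt (int K)) \<Longrightarrow> \<phi> f = 0" "\<phi> x = 1"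
    by (rule exists_separating_functional[OF V.subspace_span K]) blast
  obtain y where y: "\<And>f. \<phi> f = T2 e f y"
    by (rule functional_represented_by_T2[where e = e and K = "int K", OF e \<phi>(1)]) (auto intro: \<phi>(2) V.span_base)
  show thesis
  proof (rule that)
    show "y \<in> orth e U" using \<phi>(2) by (auto simp: orth_def y[symmetric] intro: V.span_base)
    show "T2 e x y \<noteq> 0" using \<phi>(3) by (simp add: y[symmetric])
  qed
qed

section \<open>A spanning criterion\<close>

definition mps_apply :: "('r V \<Rightarrow> complex) \<Rightarrow> ('r \<Rightarrow> 'r OJz) \<Rightarrow> 'r OJ" where
  "mps_apply \<phi> F = Abs_mps (\<lambda>\<alpha>. \<phi> (\<lambda>j. mps_coeff (F j) \<alpha>))"

lemma mps_coeff_apply [simp]: "mps_coeff (mps_apply \<phi> F) \<alpha> = \<phi> (\<lambda>j. mps_coeff (F j) \<alpha>)"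
  by (simp add: mps_apply_def)

lemma mps_apply_mult:
  assumes "V_functional \<phi>"
  shows "mps_apply \<phi> (\<lambda>j. mps_map fls_const \<rho> * F j) = \<rho> * mps_apply \<phi> F"
proof (rule mps_eqI)
  fix \<alpha> :: "'a tvar multiset"
  interpret \<phi>: module_hom V_scale "(*)" \<phi> by fact
  have "(\<lambda>j. mps_coeff (mps_map fls_const \<rho> * F j) \<alpha>)
      = (\<Sum>(\<beta>, \<gamma>)\<in>msplits \<alpha>. V_scale (mps_coeff \<rho> \<beta>) (\<lambda>j. mps_coeff (F j) \<gamma>))"
    by (rule ext) (simp add: V_sum_apply mps_coeff_mult V_scale_def case_prod_unfold)
  then show "mps_coeff (mps_apply \<phi> (\<lambda>j. mps_map fls_const \<rho> * F j)) \<alpha> = mps_coeff (\<rho> * mps_apply \<phi> F) \<alpha>"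
    by (simp add: \<phi>.sum \<phi>.scale mps_coeff_mult case_prod_unfold)
qed

text \<open>The index set of the truncated determinants in \<open>Omega_plus\<close>.\<close>

definition V_trunc :: "('r::{finite,linorder} \<Rightarrow> nat) \<Rightarrow> int \<Rightarrow> nat \<Rightarrow> ('r \<times> int) set" where
  "V_trunc e m K = {(j, k) \<in> V_index e m. - int K \<le> k}"

lemma mem_V_trunc: "(j, k) \<in> V_trunc e m K \<longleftrightarrow> k < v_exp e m j \<and> - int K \<le> k"
  by (simp add: V_trunc_def V_index_def)

lemma finite_V_trunc [simp]: "finite (V_trunc e m K)"
proof -
  have "V_trunc e m K = (SIGMA j:UNIV. {- int K..<v_exp e m j})"
    by (auto simp: mem_V_trunc)
  then show ?thesis by simp
qed

lemma V_trunc_subset: "V_trunc e m K \<subseteq> V_index e m"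
  by (auto simp: V_trunc_def)

lemma eventually_subset_V_trunc:
  assumes "finite A" "A \<subseteq> V_index e m"
  shows "\<forall>\<^sub>F K in sequentially. A \<subseteq> V_trunc e m K"
proof -
  have "\<forall>\<^sub>F K in sequentially. a \<in> V_trunc e m K" if "a \<in> A" for a
  proof -
    obtain j k where a: "a = (j, k)" by (cases a)
    have "a \<in> V_trunc e m K" if "nat (- k) \<le> K" for K
      using that \<open>a \<in> A\<close> assms(2) a by (auto simp: V_trunc_def)
    then show ?thesis by (auto simp: eventually_sequentially)
  qed
  then have "\<forall>\<^sub>F K in sequentially. \<forall>a\<in>A. a \<in> V_trunc e m K"
    using assms(1) by (simp add: eventually_ball_finite)
  then show ?thesis by (rule eventually_mono) blast
qed

text \<open>
  With the universal element \<open>g\<close> of the formal Jacobian, the coefficient of \<open>z_j^k\<close> in \<open>g F\<close>.  For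
  \<open>(j, k) \<in> V_index e m\<close> these are the coordinates of \<open>g F\<close> modulo \<open>v_m V_plus\<close>.
\<close>

definition g_coeff :: "('r \<Rightarrow> 'r OJz) \<Rightarrow> 'r \<times> int \<Rightarrow> 'r OJ" where
  "g_coeff F = (\<lambda>(j, k). mps_map (\<lambda>f. fls_nth f k) (mps_exp (t_sum j) * F j))"

lemma mps_coeff_g_coeff:
  "mps_coeff (g_coeff F (j, k)) \<alpha>
    = (\<Sum>(\<beta>, \<gamma>)\<in>msplits \<alpha>. fls_nth (mps_coeff (mps_exp (t_sum j)) \<beta> * mps_coeff (F j) \<gamma>) k)"
  by (simp add: g_coeff_def mps_coeff_mult fls_nth_sum case_prod_unfold)

text \<open>The matrix whose truncated determinants converge to the \<open>\<tau>\<close>-function.\<close>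

definition g_matrix :: "('r \<times> int \<Rightarrow> 'r V) \<Rightarrow> 'r \<times> int \<Rightarrow> 'r \<times> int \<Rightarrow> 'r OJ" where
  "g_matrix w a = g_coeff (\<lambda>j. mps_const (w a j))"

lemma mps_coeff_g_matrix:
  "mps_coeff (g_matrix w a (j, k)) \<alpha> = fls_nth (mps_coeff (mps_exp (t_sum j)) \<alpha> * w a j) k"
  by (simp add: g_matrix_def g_coeff_def)

lemma Omega_plus_g_act:
  "Omega_plus e m (g_act \<circ> w) = Abs_mps (\<lambda>\<alpha>. THE c. \<forall>\<^sub>F K in sequentially.
     mps_coeff (det_on (V_trunc e m K) (g_matrix w)) \<alpha> = c)"
proof -
  have "(\<lambda>a (j, k). mps_map (\<lambda>f. fls_nth f k) ((g_act \<circ> w) a j)) = g_matrix w"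
    by (auto simp: fun_eq_iff g_matrix_def g_coeff_def g_act_def)
  then show ?thesis by (simp add: Omega_plus_def V_trunc_def)
qed

text \<open>
  The entries of a row tend to zero, because each of the finitely many coefficients of weight at most
  \<open>Q\<close> is a Laurent series, which has a pole of finite order.
\<close>

lemma g_matrix_row_small:
  fixes w :: "'r::{finite,linorder} \<times> int \<Rightarrow> 'r V"
  obtains K :: nat where "\<And>j k. k < - int K \<Longrightarrow> g_matrix w a (j, k) \<in> wt_ideal Q"
proof -
  let ?A = "(UNIV :: 'r set) \<times> {\<alpha> :: 'r tvar multiset. wt \<alpha> \<le> Q}"
  let ?c = "\<lambda>(j, \<alpha>). mps_coeff (mps_exp (t_sum j)) \<alpha> * w a j"
  define K where "K = (\<Sum>x\<in>?A. nat (- fls_subdegree (?c x)))"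
  have fin: "finite ?A" by (simp add: finite_wt_le)
  have "g_matrix w a (j, k) \<in> wt_ideal Q" if k: "k < - int K" for j k
    unfolding wt_ideal_def
  proof (intro CollectI allI impI)
    fix \<alpha> :: "'r tvar multiset" assume "wt \<alpha> \<le> Q"
    then have "nat (- fls_subdegree (?c (j, \<alpha>))) \<le> K"
      unfolding K_def by (intro member_le_sum fin) auto
    then have "k < fls_subdegree (?c (j, \<alpha>))" using k by linarith
    then show "mps_coeff (g_matrix w a (j, k)) \<alpha> = 0"
      by (simp add: mps_coeff_g_matrix)
  qed
  then show thesis by (rule that)
qed

text \<open>
  Each of the finitely many coefficients of weight at most \<open>Q\<close> is a finite linear combination of the
  \<open>w a\<close>.  So the coordinates \<open>y a\<close> of \<open>F\<close> give an infinite sum \<open>F = \<Sum>a. y a * w a\<close> to which linear maps can be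
  applied termwise, with an error that tends to zero with the truncation.
\<close>

lemma expand_in_basis:
  fixes F :: "'r::{finite,linorder} \<Rightarrow> 'r OJz"
  assumes w: "adapted_basis e m U w" and F: "\<And>\<alpha>. (\<lambda>j. mps_coeff (F j) \<alpha>) \<in> U"
  obtains y where
    "\<And>Q. \<forall>\<^sub>F K in sequentially. \<forall>b.
        g_coeff F b - (\<Sum>a\<in>V_trunc e m K. y a * g_matrix w a b) \<in> wt_ideal Q"
    "\<And>\<phi> Q. V_functional \<phi> \<Longrightarrow> \<forall>\<^sub>F K in sequentially.
        mps_apply \<phi> F - (\<Sum>a\<in>V_trunc e m K. y a * mps_const (\<phi> (w a))) \<in> wt_ideal Q"
proof -
  let ?I = "V_index e m" and ?R = "V.representation (w ` V_index e m)"
  have inj: "inj_on w ?I" and ind: "V.independent (w ` ?I)" and span: "V.span (w ` ?I) = U"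
    using w by (auto simp: adapted_basis_def)
  define c where "c \<alpha> = (\<lambda>j. mps_coeff (F j) \<alpha>)" for \<alpha>
  define y where "y a = Abs_mps (\<lambda>\<alpha>. ?R (c \<alpha>) (w a))" for a
  have expand: "\<forall>\<^sub>F K in sequentially. \<forall>\<alpha>. wt \<alpha> \<le> Q \<longrightarrow>
      c \<alpha> = (\<Sum>a\<in>V_trunc e m K. V_scale (mps_coeff (y a) \<alpha>) (w a))" for Q
  proof -
    define A where "A = {a \<in> ?I. \<exists>\<alpha>. wt \<alpha> \<le> Q \<and> ?R (c \<alpha>) (w a) \<noteq> 0}"
    have "A = (\<Union>\<alpha>\<in>{\<alpha>. wt \<alpha> \<le> Q}. {a \<in> ?I. ?R (c \<alpha>) (w a) \<noteq> 0})" by (auto simp: A_def)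
    moreover have "finite {a \<in> ?I. ?R (c \<alpha>) (w a) \<noteq> 0}" for \<alpha>
    proof (rule finite_imageD)
      show "finite (w ` {a \<in> ?I. ?R (c \<alpha>) (w a) \<noteq> 0})"
        by (rule finite_subset[OF _ V.finite_representation[of "w ` ?I" "c \<alpha>"]]) auto
      show "inj_on w {a \<in> ?I. ?R (c \<alpha>) (w a) \<noteq> 0}"
        by (rule inj_on_subset[OF inj]) auto
    qed
    ultimately have "finite A" by (simp add: finite_wt_le)
    then have "\<forall>\<^sub>F K in sequentially. A \<subseteq> V_trunc e m K"
      by (rule eventually_subset_V_trunc) (auto simp: A_def)
    then show ?thesis
    proof (rule eventually_mono, intro allI impI)
      fix K and \<alpha> :: "'r tvar multiset"
      assume A: "A \<subseteq> V_trunc e m K" and \<alpha>: "wt \<alpha> \<le> Q"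
      have c: "c \<alpha> \<in> V.span (w ` ?I)" using F span by (simp add: c_def)
      have injK: "inj_on w (V_trunc e m K)" using inj V_trunc_subset by (rule inj_on_subset)
      have "c \<alpha> = (\<Sum>b | ?R (c \<alpha>) b \<noteq> 0. V_scale (?R (c \<alpha>) b) b)"
        using V.sum_nonzero_representation_eq[OF ind c] by simp
      also have "\<dots> = (\<Sum>b\<in>w ` V_trunc e m K. V_scale (?R (c \<alpha>) b) b)"
      proof (rule sum.mono_neutral_left)
        show "{b. ?R (c \<alpha>) b \<noteq> 0} \<subseteq> w ` V_trunc e m K"
        proof
          fix b assume b: "b \<in> {b. ?R (c \<alpha>) b \<noteq> 0}"
          then have "b \<in> w ` ?I" using V.representation_ne_zero by blast
          then show "b \<in> w ` V_trunc e m K" using b \<alpha> A by (auto simp: A_def)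
        qed
      qed auto
      also have "\<dots> = (\<Sum>a\<in>V_trunc e m K. V_scale (mps_coeff (y a) \<alpha>) (w a))"
        by (simp add: sum.reindex[OF injK] y_def)
      finally show "c \<alpha> = (\<Sum>a\<in>V_trunc e m K. V_scale (mps_coeff (y a) \<alpha>) (w a))" .
    qed
  qed
  show thesis
  proof (rule that[where y = y])
    fix Q
    show "\<forall>\<^sub>F K in sequentially. \<forall>b.
        g_coeff F b - (\<Sum>a\<in>V_trunc e m K. y a * g_matrix w a b) \<in> wt_ideal Q"
      using expand[of Q]
    proof (rule eventually_mono, intro allI)
      fix K and b :: "'r \<times> int"
      assume c: "\<forall>\<alpha>. wt \<alpha> \<le> Q \<longrightarrow>
        c \<alpha> = (\<Sum>a\<in>V_trunc e m K. V_scale (mps_coeff (y a) \<alpha>) (w a))"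
      obtain j k where b: "b = (j, k)" by (cases b)
      have "mps_coeff (g_coeff F b) \<alpha> = mps_coeff (\<Sum>a\<in>V_trunc e m K. y a * g_matrix w a b) \<alpha>"
        if \<alpha>: "wt \<alpha> \<le> Q" for \<alpha>
      proof -
        let ?g = "mps_coeff (mps_exp (t_sum j))"
        have Fj: "mps_coeff (F j) \<gamma> = (\<Sum>a\<in>V_trunc e m K. fls_const (mps_coeff (y a) \<gamma>) * w a j)"
          if "(\<beta>, \<gamma>) \<in> msplits \<alpha>" for \<beta> \<gamma>
        proof -
          have "wt \<gamma> \<le> Q" using that \<alpha> by (auto simp: mem_msplits wt_add)
          with c have "c \<gamma> j = (\<Sum>a\<in>V_trunc e m K. V_scale (mps_coeff (y a) \<gamma>) (w a)) j" by simp
          then show ?thesis by (simp add: c_def V_sum_apply V_scale_def)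
        qed
        have "mps_coeff (g_coeff F b) \<alpha> = (\<Sum>(\<beta>, \<gamma>)\<in>msplits \<alpha>. \<Sum>a\<in>V_trunc e m K.
            mps_coeff (y a) \<gamma> * fls_nth (?g \<beta> * w a j) k)"
          unfolding b mps_coeff_g_coeff
          by (rule sum.cong)
            (auto simp: Fj sum_distrib_left fls_nth_sum mult.left_commute[of _ "fls_const _"])
        also have "\<dots> = (\<Sum>a\<in>V_trunc e m K. mps_coeff (g_matrix w a b * y a) \<alpha>)"
          unfolding b mps_coeff_mult mps_coeff_g_matrix case_prod_unfold
          by (subst sum.swap) (simp add: mult.commute)
        finally show ?thesis by (simp add: mult.commute)
      qed
      then show "g_coeff F b - (\<Sum>a\<in>V_trunc e m K. y a * g_matrix w a b) \<in> wt_ideal Q"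
        unfolding wt_ideal_def by simp
    qed
  next
    fix \<phi> :: "'r V \<Rightarrow> complex" and Q assume "V_functional \<phi>"
    then interpret \<phi>: module_hom V_scale "(*)" \<phi> .
    show "\<forall>\<^sub>F K in sequentially.
        mps_apply \<phi> F - (\<Sum>a\<in>V_trunc e m K. y a * mps_const (\<phi> (w a))) \<in> wt_ideal Q"
      using expand[of Q]
      by (rule eventually_mono) (simp add: wt_ideal_def c_def[symmetric] \<phi>.sum \<phi>.scale)
  qed
qed

text \<open>
  The hypotheses on \<open>Y\<close> say that the \<open>g Y u i\<close> are triangular, with nonzero diagonal, with respect to
  the monomials modulo \<open>v_m V_plus\<close>.  Over a field and in finite dimension this would make them a basis
  of \<open>V / v_m V_plus\<close>, and since \<open>g U\<close> is isomorphic to this quotient when \<open>\<tau>_U \<noteq> 0\<close>, the \<open>Y u i\<close> would generate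
  \<open>U\<close>.  Here the diagonal is not invertible and everything is infinite, so the argument is dualized and
  truncated.

  Let \<open>\<phi>\<close> be a functional that vanishes on \<open>T\<close>, let \<open>M\<close> be the matrix of \<open>g\<close> on the basis \<open>w\<close>, and let
  \<open>f K\<close> solve \<open>M f = det M * \<phi> w\<close> for the truncation at \<open>K\<close>, by Cramer's rule.  Writing \<open>Y u i = \<Sum>a. y a * w a\<close> turns
  \<open>\<phi> (Y u i) = 0\<close> into a relation saying that \<open>\<Sum>b. (g Y u i)_b * f_b\<close> tends to zero.  As the rows of this
  system are triangular, each \<open>f_b\<close> tends to zero, hence so does \<open>M f = det M * \<phi> w\<close>.  If \<open>\<phi>\<close>
  did not vanish at some \<open>w a\<close>, every coefficient of \<open>det M\<close> would be eventually zero, and the limit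
  \<open>\<tau>_U\<close> would be zero.
\<close>

lemma span_criterion:
  fixes e :: "'r::{finite,linorder} \<Rightarrow> nat" and Y :: "'r \<Rightarrow> nat \<Rightarrow> 'r \<Rightarrow> 'r OJz"
  assumes w: "adapted_basis e m U w" and nz: "Omega_plus e m (g_act \<circ> w) \<noteq> 0"
    and T: "V.subspace T" "T \<subseteq> U"
    and Y: "\<And>u i \<alpha>. (\<lambda>j. mps_coeff (Y u i j) \<alpha>) \<in> T"
    and other: "\<And>u i j k. j \<noteq> u \<Longrightarrow> k < v_exp e m j \<Longrightarrow> g_coeff (Y u i) (j, k) = 0"
    and below: "\<And>u i k. k < v_exp e m u - 1 - int i \<Longrightarrow> g_coeff (Y u i) (u, k) = 0"
    and lead: "\<And>u i. g_coeff (Y u i) (u, v_exp e m u - 1 - int i) \<noteq> 0"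
  shows "U \<subseteq> T"
proof (rule subsetI, rule ccontr)
  fix x assume x: "x \<in> U" "x \<notin> T"
  obtain \<phi> where \<phi>: "V_functional \<phi>" "\<And>y. y \<in> T \<Longrightarrow> \<phi> y = 0" "\<phi> x = 1"
    by (rule exists_separating_functional[OF T(1) x(2)]) blast
  interpret \<phi>: module_hom V_scale "(*)" \<phi> by (rule \<phi>(1))
  let ?S = "V_trunc e m" and ?M = "g_matrix w"
  define D where "D K = det_on (?S K) ?M" for K
  have "\<exists>f. \<forall>a\<in>?S K. (\<Sum>b\<in>?S K. ?M a b * f b) = D K * mps_const (\<phi> (w a))" for K
    unfolding D_def
    by (rule det_on_solve[OF finite_V_trunc[of e m K], of ?M "\<lambda>a. mps_const (\<phi> (w a))"]) blast
  then have "\<forall>K. \<exists>f. \<forall>a\<in>?S K. (\<Sum>b\<in>?S K. ?M a b * f b) = D K * mps_const (\<phi> (w a))"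
    by blast
  from choice[OF this] obtain f where
    f: "\<And>K a. a \<in> ?S K \<Longrightarrow> (\<Sum>b\<in>?S K. ?M a b * f K b) = D K * mps_const (\<phi> (w a))"
    by blast

  (* \<Sum>_b (g Y)_b f_b = \<Sum>_a y_a (M f)_a = det M * \<Sum>_a y_a \<phi>(w_a) = det M * \<phi>(Y) = 0, up to errors *)
  have row: "\<forall>\<^sub>F K in sequentially. (\<Sum>b\<in>?S K. g_coeff (Y u i) b * f K b) \<in> wt_ideal Q" for u i Q
  proof -
    obtain y where y:
      "\<And>Q. \<forall>\<^sub>F K in sequentially. \<forall>b.
        g_coeff (Y u i) b - (\<Sum>a\<in>?S K. y a * ?M a b) \<in> wt_ideal Q"
      "\<And>\<phi> Q. V_functional \<phi> \<Longrightarrow> \<forall>\<^sub>F K in sequentially.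
        mps_apply \<phi> (Y u i) - (\<Sum>a\<in>?S K. y a * mps_const (\<phi> (w a))) \<in> wt_ideal Q"
      by (rule expand_in_basis[OF w, of "Y u i"]) (use Y T(2) in blast)+
    have "mps_apply \<phi> (Y u i) = 0" by (rule mps_eqI) (simp add: \<phi>(2) Y)
    then have "\<forall>\<^sub>F K in sequentially. 0 - (\<Sum>a\<in>?S K. y a * mps_const (\<phi> (w a))) \<in> wt_ideal Q"
      using y(2)[OF \<phi>(1), of Q] by simp
    with y(1)[of Q] show ?thesis
    proof eventually_elim
      case (elim K)
      have "(\<Sum>b\<in>?S K. (\<Sum>a\<in>?S K. y a * ?M a b) * f K b) = (\<Sum>a\<in>?S K. y a * (\<Sum>b\<in>?S K. ?M a b * f K b))"
        by (simp add: sum_distrib_left sum_distrib_right mult.assoc) (rule sum.swap)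
      also have "\<dots> = D K * (\<Sum>a\<in>?S K. y a * mps_const (\<phi> (w a)))"
        by (simp add: f sum_distrib_left mult.left_commute)
      finally have "(\<Sum>b\<in>?S K. g_coeff (Y u i) b * f K b)
          = (\<Sum>b\<in>?S K. (g_coeff (Y u i) b - (\<Sum>a\<in>?S K. y a * ?M a b)) * f K b)
            - D K * (0 - (\<Sum>a\<in>?S K. y a * mps_const (\<phi> (w a))))"
        by (simp add: left_diff_distrib sum_subtractf)
      also have "\<dots> \<in> wt_ideal Q"
        by (rule wt_ideal_diff, rule wt_ideal_sum, rule wt_ideal_mult_right)
          (use elim in \<open>blast intro: wt_ideal_mult_left\<close>)+
      finally show ?case .
    qed
  qed

  (* Place by place, downwards from the highest exponent: the row of Y u i has only the entries
     with index at most i, and its last entry cancels at the cost of a fixed shift d of the weight. *)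
  have f_small: "\<forall>\<^sub>F K in sequentially. f K (u, v_exp e m u - 1 - int i) \<in> wt_ideal Q" for u i Q
  proof (induction i arbitrary: Q rule: less_induct)
    case (less i)
    let ?b = "\<lambda>i. (u, v_exp e m u - 1 - int i)"
    obtain d where d: "\<And>g Q. g_coeff (Y u i) (?b i) * g \<in> wt_ideal (Q + d) \<Longrightarrow> g \<in> wt_ideal Q"
      by (rule wt_ideal_cancel[OF lead[of u i]]) blast
    have "\<forall>\<^sub>F K in sequentially. \<forall>i'\<in>{..<i}. f K (?b i') \<in> wt_ideal (Q + d)"
      by (rule eventually_ball_finite) (use less in auto)
    moreover have "\<forall>\<^sub>F K in sequentially. ?b ` {..i} \<subseteq> ?S K"
      by (rule eventually_subset_V_trunc) (auto simp: V_index_def)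
    ultimately show ?case using row[of u i "Q + d"]
    proof eventually_elim
      case (elim K)
      have "(\<Sum>b\<in>?S K. g_coeff (Y u i) b * f K b) = (\<Sum>b\<in>?b ` {..i}. g_coeff (Y u i) b * f K b)"
      proof (rule sum.mono_neutral_right)
        show "\<forall>b\<in>?S K - ?b ` {..i}. g_coeff (Y u i) b * f K b = 0"
        proof
          fix b assume b: "b \<in> ?S K - ?b ` {..i}"
          obtain j k where jk: "b = (j, k)" by (cases b)
          have "g_coeff (Y u i) (j, k) = 0"
          proof (cases "j = u")
            case True
            have "k < v_exp e m u - 1 - int i"
            proof (rule ccontr)
              assume "\<not> ?thesis"
              then have "b = ?b (nat (v_exp e m u - 1 - k))" "nat (v_exp e m u - 1 - k) \<le> i"
                using b True by (auto simp: jk mem_V_trunc)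
              then show False using b by blast
            qed
            then show ?thesis using below True by simp
          next
            case False
            then show ?thesis using other b by (simp add: jk mem_V_trunc)
          qed
          then show "g_coeff (Y u i) b * f K b = 0" by (simp add: jk)
        qed
      qed (use elim in auto)
      also have "\<dots> = (\<Sum>i'\<le>i. g_coeff (Y u i) (?b i') * f K (?b i'))"
        by (subst sum.reindex) (auto simp: inj_on_def)
      also have "\<dots> = g_coeff (Y u i) (?b i) * f K (?b i)
          + (\<Sum>i'<i. g_coeff (Y u i) (?b i') * f K (?b i'))"
        by (simp add: lessThan_Suc_atMost[symmetric])
      finally have "g_coeff (Y u i) (?b i) * f K (?b i)
        = (\<Sum>b\<in>?S K. g_coeff (Y u i) b * f K b) - (\<Sum>i'<i. g_coeff (Y u i) (?b i') * f K (?b i'))"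
        by simp
      also have "\<dots> \<in> wt_ideal (Q + d)"
        by (rule wt_ideal_diff, use elim in blast, rule wt_ideal_sum, rule wt_ideal_mult_left)
          (use elim in blast)
      finally show ?case by (rule d)
    qed
  qed

  (* Row a of M f: all but finitely many entries of M are small, and for the others f is small. *)
  have det_small: "\<forall>\<^sub>F K in sequentially. D K * mps_const (\<phi> (w a)) \<in> wt_ideal Q"
    if a: "a \<in> V_index e m" for a Q
  proof -
    obtain K1 :: nat where K1: "\<And>j k. k < - int K1 \<Longrightarrow> ?M a (j, k) \<in> wt_ideal Q"
      by (rule g_matrix_row_small) blast
    have "\<forall>\<^sub>F K in sequentially. f K b \<in> wt_ideal Q" if "b \<in> ?S K1" for b
    proof -
      obtain j k where jk: "b = (j, k)" by (cases b)
      then have "b = (j, v_exp e m j - 1 - int (nat (v_exp e m j - 1 - k)))"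
        using that by (simp add: mem_V_trunc)
      then show ?thesis using f_small by metis
    qed
    then have "\<forall>\<^sub>F K in sequentially. \<forall>b\<in>?S K1. f K b \<in> wt_ideal Q"
      by (simp add: eventually_ball_finite)
    moreover have "\<forall>\<^sub>F K in sequentially. {a} \<subseteq> ?S K"
      by (rule eventually_subset_V_trunc) (use a in auto)
    ultimately show ?thesis
    proof eventually_elim
      case (elim K)
      have "?M a b * f K b \<in> wt_ideal Q" if b: "b \<in> ?S K" for b
      proof (cases "b \<in> ?S K1")
        case True
        then show ?thesis using elim(1) by (auto intro: wt_ideal_mult_left)
      next
        case False
        obtain j k where jk: "b = (j, k)" by (cases b)
        have "k < - int K1" using False b by (auto simp: jk mem_V_trunc)
        then show ?thesis unfolding jk by (intro wt_ideal_mult_right K1)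
      qed
      then have "(\<Sum>b\<in>?S K. ?M a b * f K b) \<in> wt_ideal Q" by (rule wt_ideal_sum)
      then show ?case using f elim(2) by simp
    qed
  qed

  have "\<exists>a\<in>V_index e m. \<phi> (w a) \<noteq> 0"
  proof (rule ccontr)
    assume *: "\<not> ?thesis"
    have "x \<in> V.span (w ` V_index e m)" using w x(1) by (simp add: adapted_basis_def)
    then have "\<phi> x = 0"
    proof (induction rule: V.span_induct_alt)
      case base
      show ?case by (rule \<phi>.zero)
    next
      case (step c y z)
      then have "\<phi> y = 0" using * by auto
      with step show ?case unfolding \<phi>.add \<phi>.scale by simp
    qed
    then show False using \<phi>(3) by simp
  qed
  then obtain a where a: "a \<in> V_index e m" "\<phi> (w a) \<noteq> 0" by blast
  have D0: "\<forall>\<^sub>F K in sequentially. mps_coeff (D K) \<alpha> = 0" for \<alpha>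
    using det_small[OF a(1), of "wt \<alpha>"]
    by (rule eventually_mono) (use a(2) in \<open>auto simp: wt_ideal_def\<close>)
  have "Omega_plus e m (g_act \<circ> w) = 0"
  proof (rule mps_eqI)
    fix \<alpha>
    have "(THE c. \<forall>\<^sub>F K in sequentially. mps_coeff (D K) \<alpha> = c) = 0"
    proof (rule the_equality)
      show "\<forall>\<^sub>F K in sequentially. mps_coeff (D K) \<alpha> = 0" by (rule D0)
    next
      fix c assume "\<forall>\<^sub>F K in sequentially. mps_coeff (D K) \<alpha> = c"
      with D0[of \<alpha>] have "\<forall>\<^sub>F K :: nat in sequentially. c = 0" by eventually_elim simp
      then show "c = 0" by simp
    qed
    then show "mps_coeff (Omega_plus e m (g_act \<circ> w)) \<alpha> = mps_coeff 0 \<alpha>"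
      by (simp add: Omega_plus_g_act D_def)
  qed
  then show False using nz by simp
qed

section \<open>The numerators of the Baker-Akhiezer functions\<close>

lemma mps_coeff_t_sum_empty [simp]: "mps_coeff (t_sum j) {#} = 0"
  by (simp add: t_sum_def)

lemma mps_exp_t_sum_cancel: "mps_exp (t_sum j) * (mps_exp (- t_sum j) * f) = f"
  using mps_exp_mult_exp_uminus[of "t_sum j"] by (simp add: mult.assoc[symmetric])

lemma mps_pderiv_t_sum:
  "mps_pderiv (u, i) (t_sum j) = mps_const (if j = u then fls_X_intpow (- int (Suc i)) else 0)"
proof (rule mps_eqI)
  fix \<alpha> :: "'a tvar multiset"
  have "{i'. add_mset (u, i) \<alpha> = {#(j, i')#}} = (if j = u \<and> \<alpha> = {#} then {i} else {})"
    by auto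
  then show "mps_coeff (mps_pderiv (u, i) (t_sum j)) \<alpha>
      = mps_coeff (mps_const (if j = u then fls_X_intpow (- int (Suc i)) else 0)) \<alpha>"
    by (auto simp: mps_coeff_pderiv t_sum_def mps_coeff_const)
qed

text \<open>At \<open>z_j = 0\<close> the substitution \<open>t \<mapsto> t + [z_j]\<close> is the identity.\<close>

lemma t_plus_prod_at_0:
  "fps_nth (mps_coeff (\<Prod>x\<in>#\<gamma>. t_plus j x) \<alpha>) 0 = (if \<alpha> = \<gamma> then 1 else 0)"
proof (induction \<gamma> arbitrary: \<alpha>)
  case empty
  then show ?case by (simp add: mps_coeff_one)
next
  case (add x \<gamma>)
  have lead: "fps_nth (mps_coeff (t_plus j x) \<beta>) 0 = (if \<beta> = {#x#} then 1 else 0)" for \<beta>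
    by (simp add: t_plus_def mps_var_def mps_coeff_const)
  have "fps_nth (mps_coeff (\<Prod>x\<in>#add_mset x \<gamma>. t_plus j x) \<alpha>) 0
      = (\<Sum>(\<beta>, \<delta>)\<in>msplits \<alpha>. if (\<beta>, \<delta>) = ({#x#}, \<gamma>) then 1 else 0)"
    by (auto simp: mps_coeff_mult fps_sum_nth lead add.IH intro!: sum.cong split: if_splits)
  also have "\<dots> = (\<Sum>p\<in>msplits \<alpha>. if p = ({#x#}, \<gamma>) then 1 else 0)"
    by (rule sum.cong) (auto split: if_splits)
  also have "\<dots> = (if \<alpha> = add_mset x \<gamma> then 1 else 0)"
    by (auto simp: mem_msplits)
  finally show ?case .
qed

lemma tau_plus_below: "k < 0 \<Longrightarrow> fls_nth (mps_coeff (tau_plus j \<tau>) \<alpha>) k = 0"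
  by (simp add: tau_plus_def)

lemma tau_plus_at_0: "fls_nth (mps_coeff (tau_plus j \<tau>) \<alpha>) 0 = mps_coeff \<tau> \<alpha>"
proof -
  have "Sum_any (\<lambda>\<gamma>. mps_coeff \<tau> \<gamma> * (if \<alpha> = \<gamma> then 1 else 0)) = mps_coeff \<tau> \<alpha>"
    by (subst Sum_any.expand_superset[of "{\<alpha>}"]) (auto split: if_splits)
  then show ?thesis by (simp add: tau_plus_def t_plus_prod_at_0)
qed

text \<open>
  \<open>\<tau>_U(t) v_m (1, \<dots>, z_u, \<dots>, 1)^{-1} \<psi>_{u,U}(z_\<bullet>, t)\<close>, the series whose coefficients the normalization puts
  into \<open>U\<close>.
\<close>

definition ba_vec ::
  "('r::{finite,linorder} \<Rightarrow> nat) \<Rightarrow> int \<Rightarrow> ('r \<Rightarrow> 'r \<Rightarrow> 'r OJ) \<Rightarrow> 'r \<Rightarrow> 'r \<Rightarrow> 'r OJz" where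
  "ba_vec e m \<tau> u = (\<lambda>j. mps_const (zpow (\<lambda>j. v_exp e m j - of_bool (j = u)) j) * ba_num \<tau> u j)"

text \<open>
  Let \<open>X = ba_vec e m \<tau> u\<close>.  Then \<open>g X = v_m (1, \<dots>, z_u, \<dots>, 1)^{-1} P\<close>, where the \<open>j\<close>-th component of \<open>P\<close> is
  \<open>\<tau>_{U_{uj}}(t + [z_j])\<close>, a power series in \<open>z_j\<close> with the value \<open>\<tau>_U(t)\<close> at zero for \<open>j = u\<close>.  So modulo
  \<open>v_m V_plus\<close> only the term \<open>\<tau>_U z_u^{v_u - 1}\<close> is left, where \<open>v_u\<close> is the exponent of \<open>v_m\<close> in the place
  \<open>u\<close>.  The partial derivatives of \<open>X\<close> have coefficients in the same span, and \<open>g \<partial>X\<close>, for the variable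
  \<open>t^{(u)}_i\<close>, is the derivative of \<open>g X\<close>, which has no new poles, minus \<open>z_u^{-i}\<close> times the \<open>u\<close>-th
  component of \<open>g X\<close>.  So \<open>X\<close> and its derivatives with
  respect to the \<open>t^{(u)}_i\<close>, for all \<open>u\<close>, have the triangular shape that the criterion asks for.
\<close>

lemma ba_vec_coeffs_span:
  fixes e :: "'r::{finite,linorder} \<Rightarrow> nat"
  assumes \<tau>: "tau_system e m U \<tau>"
    and coeffs: "\<And>u \<alpha>. (\<lambda>j. mps_coeff (ba_vec e m \<tau> u j) \<alpha>) \<in> U"
  shows "U \<subseteq> V.span (\<Union>u. range (\<lambda>\<alpha> j. mps_coeff (ba_vec e m \<tau> u j) \<alpha>))"
proof -
  define a where "a u j = v_exp e m j - of_bool (j = u)" for u j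
  define P where "P u j = mps_const (fls_X_intpow (a u j)) * tau_plus j (\<tau> u j)" for u j
  have ba: "ba_vec e m \<tau> u j = mps_exp (- t_sum j) * P u j" for u j
    by (simp add: ba_vec_def ba_num_def P_def zpow_def a_def mult.left_commute)
  define T where "T = V.span (\<Union>u. range (\<lambda>\<alpha> j. mps_coeff (ba_vec e m \<tau> u j) \<alpha>))"
  (* \<open>t^{(u)}_i\<close> is the variable (u, i - 1); the undifferentiated series takes the index 0. *)
  define Y where "Y u i j = (case i of 0 \<Rightarrow> ba_vec e m \<tau> u j
    | Suc i \<Rightarrow> mps_pderiv (u, i) (ba_vec e m \<tau> u j))" for u i j

  have shift_nth: "fls_nth (fls_shift n 1 * f) k = fls_nth f (k + n)" for n k and f :: "complex fls"
    using fls_X_intpow_times_conv_shift(1)[of "- n" f] by simp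
  have P_nth: "fls_nth (mps_coeff (P u j) \<alpha>) k = fls_nth (mps_coeff (tau_plus j (\<tau> u j)) \<alpha>) (k - a u j)"
    for u j \<alpha> k
    by (simp add: P_def shift_nth)
  have P_below: "fls_nth (mps_coeff (P u j) \<alpha>) k = 0" if "k < a u j" for u j \<alpha> k
    unfolding P_nth by (rule tau_plus_below) (use that in simp)
  have g_Suc: "g_coeff (Y u (Suc i)) (j, k) = mps_map (\<lambda>f. fls_nth f k)
      (mps_pderiv (u, i) (P u j) - mps_const (if j = u then fls_X_intpow (- int (Suc i)) else 0) * P u j)"
    for u i j k
  proof -
    have neg: "mps_pderiv x (- f) = - mps_pderiv x f" for x and f :: "'r OJz"
      by (rule mps_eqI) (simp add: mps_coeff_pderiv del: of_nat_Suc)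
    have "mps_pderiv (u, i) (ba_vec e m \<tau> u j) = mps_exp (- t_sum j) *
       (mps_pderiv (u, i) (P u j) - mps_const (if j = u then fls_X_intpow (- int (Suc i)) else 0) * P u j)"
      unfolding ba mps_pderiv_mult
      by (subst mps_pderiv_exp) (simp, simp only: neg mps_pderiv_t_sum, simp add: algebra_simps)
    then show ?thesis by (simp add: g_coeff_def Y_def mps_exp_t_sum_cancel)
  qed
  have g_0: "g_coeff (Y u 0) (j, k) = mps_map (\<lambda>f. fls_nth f k) (P u j)" for u j k
    by (simp add: g_coeff_def Y_def ba mps_exp_t_sum_cancel)
  have pderiv_P_below: "fls_nth (mps_coeff (mps_pderiv x (P u j)) \<alpha>) k = 0" if "k < a u j" for x u j \<alpha> k
    using P_below[OF that] by (simp add: mps_coeff_pderiv fls_of_nat del: of_nat_Suc)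

  obtain u0 :: 'r where True by simp
  have "is_tau e m U (\<tau> u0 u0)"
  proof -
    have "zpow (\<lambda>i. of_bool (i = u0) - of_bool (i = u0)) = 1" by (simp add: zpow_def fun_eq_iff)
    then have "U_shift u0 u0 U = U" by (simp add: U_shift_def)
    then show ?thesis using \<tau> unfolding tau_system_def by metis
  qed
  then obtain w where w: "adapted_basis e m U w" "\<tau> u0 u0 = Omega_plus e m (g_act \<circ> w)"
    by (auto simp: is_tau_def)
  have nz: "\<tau> u u \<noteq> 0" for u using \<tau> by (simp add: tau_system_def)

  have "U \<subseteq> T"
  proof (rule span_criterion[OF w(1), where Y = Y])
    show "Omega_plus e m (g_act \<circ> w) \<noteq> 0" using w(2) nz[of u0] by simp
    show "V.subspace T" by (simp add: T_def)
    have "V.subspace U" using w(1) by (auto simp: adapted_basis_def)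
    then show "T \<subseteq> U" unfolding T_def using coeffs by (intro V.span_minimal) auto
  next
    fix u i and \<alpha> :: "'r tvar multiset"
    have base: "(\<lambda>j. mps_coeff (ba_vec e m \<tau> u j) \<alpha>) \<in> T" for \<alpha>
      unfolding T_def by (rule V.span_base) auto
    show "(\<lambda>j. mps_coeff (Y u i j) \<alpha>) \<in> T"
    proof (cases i)
      case 0
      then show ?thesis using base by (simp add: Y_def)
    next
      case (Suc i')
      have "(\<lambda>j. mps_coeff (Y u i j) \<alpha>) = V_scale (of_nat (Suc (count \<alpha> (u, i'))))
          (\<lambda>j. mps_coeff (ba_vec e m \<tau> u j) (add_mset (u, i') \<alpha>))"
        by (simp add: Suc Y_def mps_coeff_pderiv V_scale_def fls_of_nat del: of_nat_Suc)
      also have "\<dots> \<in> T" using base unfolding T_def by (intro V.span_scale)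
      finally show ?thesis .
    qed
  next
    fix u i j k assume "j \<noteq> u" "k < v_exp e m j"
    then have "k < a u j" "j \<noteq> u" by (simp_all add: a_def)
    then show "g_coeff (Y u i) (j, k) = 0"
      by (cases i) (auto intro!: mps_eqI simp: g_0 g_Suc P_below pderiv_P_below)
  next
    fix u i k assume "k < v_exp e m u - 1 - int i"
    then have "k < a u u - int i" by (simp add: a_def)
    then show "g_coeff (Y u i) (u, k) = 0"
      by (cases i) (auto intro!: mps_eqI
        simp: g_0 g_Suc P_below pderiv_P_below shift_nth)
  next
    fix u i
    let ?k = "v_exp e m u - 1 - int i"
    have "g_coeff (Y u i) (u, ?k) = (if i = 0 then \<tau> u u else - \<tau> u u)"
    proof (rule mps_eqI)
      fix \<alpha>
      have "fls_nth (mps_coeff (P u u) \<alpha>) (v_exp e m u - 1) = mps_coeff (\<tau> u u) \<alpha>"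
        by (simp add: P_nth a_def tau_plus_at_0)
      then show "mps_coeff (g_coeff (Y u i) (u, ?k)) \<alpha> = mps_coeff (if i = 0 then \<tau> u u else - \<tau> u u) \<alpha>"
        by (cases i) (simp_all add: g_0 g_Suc pderiv_P_below a_def shift_nth)
    qed
    then show "g_coeff (Y u i) (u, ?k) \<noteq> 0" using nz[of u] by (simp split: if_splits)
  qed
  then show ?thesis by (simp add: T_def)
qed

lemma normalized_ba_vec_in:
  fixes e :: "'r::{finite,linorder} \<Rightarrow> nat"
  assumes "normalized e m U \<tau> \<sigma>"
  shows "(\<lambda>j. mps_coeff (ba_vec e m \<tau> u j) \<alpha>) \<in> U"
proof -
  have nz: "\<tau> u u \<noteq> 0" using assms by (simp add: normalized_def tau_system_def)
  obtain F where F: "\<And>j. OJ_mult (\<tau> u u) (zpow_mult (\<lambda>j. v_exp e m j - of_bool (j = u)) (ba \<tau> u)) j = Fract (F j) 1"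
    "\<And>\<alpha>. (\<lambda>j. mps_coeff (F j) \<alpha>) \<in> U"
    using assms unfolding normalized_def coeffs_in_def by meson
  have "F j = ba_vec e m \<tau> u j" for j
  proof -
    have "Fract (mps_map fls_const (\<tau> u u) * ba_vec e m \<tau> u j) (mps_map fls_const (\<tau> u u)) = Fract (F j) 1"
      using F(1)[of j] by (simp add: OJ_mult_def zpow_mult_def ba_def ba_vec_def)
    then show ?thesis using nz by (simp add: eq_fract mult.commute)
  qed
  then show ?thesis using F(2)[of \<alpha>] by simp
qed

text \<open>
  The normalization says this for the coefficients of \<open>\<tau>_U(t) / \<sigma>(-t)\<close> times the series at \<open>-t\<close>, where
  \<open>\<sigma>\<close> is the \<open>\<tau>\<close>-function of \<open>U\<^sup>\<bottom>\<close>.  The pairing with an element of \<open>U\<close> is linear over \<open>\<O>(J)\<close>, which is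
  an integral domain, so this factor can be cleared.
\<close>

lemma normalized_adj_ba_vec_in:
  fixes e :: "'r::{finite,linorder} \<Rightarrow> nat"
  assumes e: "\<And>i. e i > 0" and norm: "normalized e m U \<tau> \<sigma>"
  shows "(\<lambda>j. mps_coeff (ba_vec e (r_of e - n_of e - m) \<sigma> u j) \<alpha>) \<in> orth e U"
proof -
  let ?m' = "r_of e - n_of e - m"
  let ?X = "ba_vec e ?m' \<sigma> u" and ?\<sigma> = "mps_neg_vars (\<sigma> u u)"
  have nz: "\<tau> u u \<noteq> 0" "?\<sigma> \<noteq> 0" using norm by (simp_all add: normalized_def tau_system_def)
  obtain F where F: "\<And>j. OJ_mult (\<tau> u u) (zpow_mult (\<lambda>j. v_exp e ?m' j - of_bool (j = u)) (ba_adj \<sigma> u)) j = Fract (F j) 1"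
    "\<And>\<alpha>. (\<lambda>j. mps_coeff (F j) \<alpha>) \<in> orth e U"
    using norm unfolding normalized_def coeffs_in_def by meson
  have eq: "mps_map fls_const (\<tau> u u) * mps_neg_vars (?X j) = mps_map fls_const ?\<sigma> * F j" for j
  proof -
    have "Fract (mps_map fls_const (\<tau> u u) * mps_neg_vars (?X j)) (mps_map fls_const ?\<sigma>) = Fract (F j) 1"
      using F(1)[of j] by (simp add: OJ_mult_def zpow_mult_def ba_adj_def ba_vec_def mps_neg_vars_mult
          mps_neg_vars_const mps_neg_vars_map_fls_const)
    then show ?thesis using nz by (simp add: eq_fract mult.commute)
  qed
  have "T2 e x (\<lambda>j. mps_coeff (?X j) \<alpha>) = 0" if x: "x \<in> U" for x
  proof -
    have T2x: "V_functional (T2 e x)" by (rule V_functional_T2_right[where e = e, OF e])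
    then interpret T: module_hom V_scale "(*)" "T2 e x" .
    have "mps_apply (T2 e x) F = 0"
      using F(2) x by (intro mps_eqI) (simp add: orth_def)
    then have "\<tau> u u * mps_apply (T2 e x) (\<lambda>j. mps_neg_vars (?X j)) = 0"
      unfolding mps_apply_mult[OF T2x, symmetric] eq by (simp add: mps_apply_mult[OF T2x])
    then have "mps_coeff (mps_apply (T2 e x) (\<lambda>j. mps_neg_vars (?X j))) \<alpha> = 0"
      using nz by simp
    moreover have "(\<lambda>j. mps_coeff (mps_neg_vars (?X j)) \<alpha>)
        = V_scale ((-1) ^ size \<alpha>) (\<lambda>j. mps_coeff (?X j) \<alpha>)"
      by (simp add: V_scale_def fls_const_power)
    ultimately show ?thesis by (simp add: T.scale)
  qed
  then show ?thesis by (simp add: orth_def)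
qed

section \<open>The pairing of Baker-Akhiezer functions\<close>

text \<open>
  A monomial in two sets of variables is a pair of monomials; \<open>mset_left\<close> and \<open>mset_right\<close> are the
  components that occur in \<open>mps_outer\<close>.
\<close>

definition mset_left :: "('v + 'w) multiset \<Rightarrow> 'v multiset" where
  "mset_left \<gamma> = image_mset projl (filter_mset isl \<gamma>)"

definition mset_right :: "('v + 'w) multiset \<Rightarrow> 'w multiset" where
  "mset_right \<gamma> = image_mset projr (filter_mset (\<lambda>x. \<not> isl x) \<gamma>)"

lemma mset_left_simps [simp]:
  "mset_left (\<gamma> + \<delta>) = mset_left \<gamma> + mset_left \<delta>"
  "mset_left (image_mset Inl \<alpha>) = \<alpha>" "mset_left (image_mset Inr \<beta>) = {#}"
  by (simp_all add: mset_left_def filter_mset_image_mset multiset.map_comp o_def)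

lemma mset_right_simps [simp]:
  "mset_right (\<gamma> + \<delta>) = mset_right \<gamma> + mset_right \<delta>"
  "mset_right (image_mset Inl \<alpha>) = {#}" "mset_right (image_mset Inr \<beta>) = \<beta>"
  by (simp_all add: mset_right_def filter_mset_image_mset multiset.map_comp o_def)

lemma mset_left_right: "image_mset Inl (mset_left \<gamma>) + image_mset Inr (mset_right \<gamma>) = \<gamma>"
proof (induction \<gamma>)
  case (add x \<gamma>)
  then show ?case by (cases x) (simp_all add: mset_left_def mset_right_def)
qed (simp add: mset_left_def mset_right_def)

lemma mps_coeff_outer: "mps_coeff (mps_outer h a b) \<gamma> = h (a (mset_left \<gamma>)) (b (mset_right \<gamma>))"
  by (simp add: mps_outer_def mset_left_def mset_right_def)

lemma mps_outer_eq_0_iff: "mps_outer h a b = 0 \<longleftrightarrow> (\<forall>\<alpha> \<beta>. h (a \<alpha>) (b \<beta>) = 0)"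
proof
  assume *: "mps_outer h a b = 0"
  show "\<forall>\<alpha> \<beta>. h (a \<alpha>) (b \<beta>) = 0"
  proof (intro allI)
    fix \<alpha> \<beta>
    show "h (a \<alpha>) (b \<beta>) = 0"
      using arg_cong[OF *, of "\<lambda>f. mps_coeff f (image_mset Inl \<alpha> + image_mset Inr \<beta>)"]
      by (simp add: mps_coeff_outer)
  qed
qed (auto intro: mps_eqI simp: mps_coeff_outer)

text \<open>A factorization of a monomial in two sets of variables is a pair of factorizations.\<close>

lemma sum_msplits_outer:
  "(\<Sum>(\<beta>, \<delta>)\<in>msplits \<gamma>. F (mset_left \<beta>) (mset_left \<delta>) (mset_right \<beta>) (mset_right \<delta>))
    = (\<Sum>(\<alpha>, \<alpha>')\<in>msplits (mset_left \<gamma>). \<Sum>(\<beta>, \<beta>')\<in>msplits (mset_right \<gamma>). F \<alpha> \<alpha>' \<beta> \<beta>')"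
proof -
  have "(\<Sum>(\<beta>, \<delta>)\<in>msplits \<gamma>. F (mset_left \<beta>) (mset_left \<delta>) (mset_right \<beta>) (mset_right \<delta>))
    = (\<Sum>((\<alpha>, \<alpha>'), (\<beta>, \<beta>'))\<in>msplits (mset_left \<gamma>) \<times> msplits (mset_right \<gamma>). F \<alpha> \<alpha>' \<beta> \<beta>')"
  proof (rule sum.reindex_bij_witness[
        where j = "\<lambda>(\<beta>, \<delta>). ((mset_left \<beta>, mset_left \<delta>), (mset_right \<beta>, mset_right \<delta>))"
          and i = "\<lambda>((\<alpha>, \<alpha>'), (\<beta>, \<beta>')). (image_mset Inl \<alpha> + image_mset Inr \<beta>, image_mset Inl \<alpha>' + image_mset Inr \<beta>')"])
    fix p assume "p \<in> msplits (mset_left \<gamma>) \<times> msplits (mset_right \<gamma>)"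
    then obtain \<alpha> \<alpha>' \<beta> \<beta>' where p: "p = ((\<alpha>, \<alpha>'), (\<beta>, \<beta>'))"
      "\<alpha> + \<alpha>' = mset_left \<gamma>" "\<beta> + \<beta>' = mset_right \<gamma>" by (auto simp: mem_msplits)
    have "image_mset Inl \<alpha> + image_mset Inr \<beta> + (image_mset Inl \<alpha>' + image_mset Inr \<beta>')
        = image_mset Inl (\<alpha> + \<alpha>') + image_mset Inr (\<beta> + \<beta>')" by simp
    also have "\<dots> = \<gamma>" unfolding p mset_left_right ..
    finally show "(\<lambda>((\<alpha>, \<alpha>'), (\<beta>, \<beta>')). (image_mset Inl \<alpha> + image_mset Inr \<beta>,
        image_mset Inl \<alpha>' + image_mset Inr \<beta>')) p \<in> msplits \<gamma>"
      by (simp add: p(1) mem_msplits)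
  qed (auto simp: mem_msplits mset_left_right)
  also have "\<dots> = (\<Sum>(\<alpha>, \<alpha>')\<in>msplits (mset_left \<gamma>). \<Sum>(\<beta>, \<beta>')\<in>msplits (mset_right \<gamma>). F \<alpha> \<alpha>' \<beta> \<beta>')"
    by (subst sum.cartesian_product[symmetric]) (simp add: case_prod_unfold)
  finally show ?thesis .
qed

abbreviation T2_outer ::
  "('r::finite \<Rightarrow> nat) \<Rightarrow> ('r \<Rightarrow> 'r OJz) \<Rightarrow> ('r \<Rightarrow> 'r OJz) \<Rightarrow> ('r tvar + 'r tvar, complex) mps" where
  "T2_outer e A B \<equiv> mps_outer (T2 e) (\<lambda>\<alpha> j. mps_coeff (A j) \<alpha>) (\<lambda>\<beta> j. mps_coeff (B j) \<beta>)"

lemma T2_outer_mult: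
  assumes e: "\<And>i. e i > 0"
  shows "T2_outer e (\<lambda>j. mps_map fls_const \<rho> * A j) (\<lambda>j. mps_map fls_const \<rho>' * B j)
    = mps_outer (*) (mps_coeff \<rho>) (mps_coeff \<rho>') * T2_outer e A B"
proof (rule mps_eqI)
  fix \<gamma>
  let ?A = "\<lambda>\<alpha> j. mps_coeff (A j) \<alpha>" and ?B = "\<lambda>\<beta> j. mps_coeff (B j) \<beta>"
  have left: "T2 e (\<lambda>j. mps_coeff (mps_map fls_const \<rho> * A j) \<alpha>) b
      = (\<Sum>(\<alpha>', \<alpha>'')\<in>msplits \<alpha>. mps_coeff \<rho> \<alpha>' * T2 e (?A \<alpha>'') b)" for \<alpha> b
    using arg_cong[OF mps_apply_mult[OF V_functional_T2_left[where e = e, OF e]], of "\<lambda>f. mps_coeff f \<alpha>"]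
    by (simp add: mps_coeff_mult[of \<rho> "mps_apply _ _"])
  have right: "T2 e a (\<lambda>j. mps_coeff (mps_map fls_const \<rho>' * B j) \<beta>)
      = (\<Sum>(\<beta>', \<beta>'')\<in>msplits \<beta>. mps_coeff \<rho>' \<beta>' * T2 e a (?B \<beta>''))" for \<beta> a
    using arg_cong[OF mps_apply_mult[OF V_functional_T2_right[where e = e, OF e]], of "\<lambda>f. mps_coeff f \<beta>"]
    by (simp add: mps_coeff_mult[of \<rho>' "mps_apply _ _"])
  show "mps_coeff (T2_outer e (\<lambda>j. mps_map fls_const \<rho> * A j) (\<lambda>j. mps_map fls_const \<rho>' * B j)) \<gamma>
    = mps_coeff (mps_outer (*) (mps_coeff \<rho>) (mps_coeff \<rho>') * T2_outer e A B) \<gamma>"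
    unfolding mps_coeff_mult[of "mps_outer _ _ _"] mps_coeff_outer left right
      sum_msplits_outer[of "\<lambda>\<alpha> \<alpha>' \<beta> \<beta>'. mps_coeff \<rho> \<alpha> * mps_coeff \<rho>' \<beta> * T2 e (?A \<alpha>') (?B \<beta>')"]
    by (simp add: case_prod_unfold sum_distrib_left mult.assoc)
qed

text \<open>
  The value does not depend on the representation: two of them become equal after multiplication of
  each with the denominators of the other, and by the previous lemma this multiplies numerator and
  denominator of the value in the same way.
\<close>

lemma T2_fun_Fract:
  fixes e :: "'r::finite \<Rightarrow> nat"
  assumes e: "\<And>i. e i > 0" and nz: "\<rho> \<noteq> 0" "\<rho>' \<noteq> 0"
    and \<psi>: "\<And>j. \<psi> j = Fract (A j) (mps_map fls_const \<rho>)"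
    and \<phi>: "\<And>j. \<phi> j = Fract (B j) (mps_map fls_const \<rho>')"
  shows "T2_fun e \<psi> \<phi> = Fract (T2_outer e A B) (mps_outer (*) (mps_coeff \<rho>) (mps_coeff \<rho>'))"
  unfolding T2_fun_def
proof (rule the_equality)
  show "\<exists>A' \<rho>1 B' \<rho>1'. \<rho>1 \<noteq> 0 \<and> \<rho>1' \<noteq> 0 \<and>
     (\<forall>j. \<psi> j = Fract (A' j) (mps_map fls_const \<rho>1)) \<and> (\<forall>j. \<phi> j = Fract (B' j) (mps_map fls_const \<rho>1')) \<and>
     Fract (T2_outer e A B) (mps_outer (*) (mps_coeff \<rho>) (mps_coeff \<rho>'))
       = Fract (T2_outer e A' B') (mps_outer (*) (mps_coeff \<rho>1) (mps_coeff \<rho>1'))"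
    using nz \<psi> \<phi> by blast
next
  fix x assume "\<exists>A' \<rho>1 B' \<rho>1'. \<rho>1 \<noteq> 0 \<and> \<rho>1' \<noteq> 0 \<and>
     (\<forall>j. \<psi> j = Fract (A' j) (mps_map fls_const \<rho>1)) \<and> (\<forall>j. \<phi> j = Fract (B' j) (mps_map fls_const \<rho>1')) \<and>
     x = Fract (T2_outer e A' B') (mps_outer (*) (mps_coeff \<rho>1) (mps_coeff \<rho>1'))"
  then obtain A' \<rho>1 B' \<rho>1' where nz': "\<rho>1 \<noteq> 0" "\<rho>1' \<noteq> 0"
    and \<psi>': "\<And>j. \<psi> j = Fract (A' j) (mps_map fls_const \<rho>1)"
    and \<phi>': "\<And>j. \<phi> j = Fract (B' j) (mps_map fls_const \<rho>1')"
    and x: "x = Fract (T2_outer e A' B') (mps_outer (*) (mps_coeff \<rho>1) (mps_coeff \<rho>1'))" by blast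
  have outer_nz: "mps_outer (*) (mps_coeff f) (mps_coeff g) \<noteq> 0" if "f \<noteq> 0" "g \<noteq> 0" for f g :: "'r OJ"
    using mps_nonzero[OF that(1)] mps_nonzero[OF that(2)] by (auto simp: mps_outer_eq_0_iff)
  have A: "mps_map fls_const \<rho>1 * A j = mps_map fls_const \<rho> * A' j" for j
    using \<psi>[of j] \<psi>'[of j] nz nz' by (simp add: eq_fract mult.commute)
  have B: "mps_map fls_const \<rho>1' * B j = mps_map fls_const \<rho>' * B' j" for j
    using \<phi>[of j] \<phi>'[of j] nz nz' by (simp add: eq_fract mult.commute)
  have "mps_outer (*) (mps_coeff \<rho>1) (mps_coeff \<rho>1') * T2_outer e A B
      = mps_outer (*) (mps_coeff \<rho>) (mps_coeff \<rho>') * T2_outer e A' B'"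
    unfolding T2_outer_mult[where e = e, OF e, symmetric] A B ..
  then show "x = Fract (T2_outer e A B) (mps_outer (*) (mps_coeff \<rho>) (mps_coeff \<rho>'))"
    unfolding x using nz nz' outer_nz by (simp add: eq_fract mult.commute)
qed

text \<open>
  \<open>v_m v_{r-n-m} = z^{-1} z_\<bullet>\<close>: exactly one of the two indices lies above \<open>(r - n) / 2\<close>, and there \<open>v\<close> is
  defined by this identity.
\<close>

lemma v_exp_duality:
  assumes "2 * m \<noteq> r_of e - n_of e"
  shows "v_exp e m j + v_exp e (r_of e - n_of e - m) j = 1 - int (e j)"
  using assms by (auto simp: v_exp_def)

text \<open>
  The factors \<open>z_\<bullet>\<close> and \<open>z^{-1}\<close> have the product \<open>v_m v_{r-n-m}\<close>, so they can be exchanged for \<open>v_m\<close> on the left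
  and \<open>v_{r-n-m}\<close> on the right, which turns both arguments into the normalized series up to
  denominators and signs.
\<close>

lemma T2_fun_ba_eq_0_iff:
  fixes e :: "'r::{finite,linorder} \<Rightarrow> nat"
  assumes e: "\<And>i. e i > 0" and m: "2 * m \<noteq> r_of e - n_of e"
    and nz: "\<tau> u u \<noteq> 0" "\<sigma> v v \<noteq> 0"
  shows "T2_fun e (zpow_mult (\<lambda>j. 1 - of_bool (j = u)) (ba \<tau> u))
      (zpow_mult (\<lambda>j. - int (e j) - of_bool (j = v)) (ba_adj \<sigma> v)) = 0
    \<longleftrightarrow> (\<forall>\<alpha> \<beta>. T2 e (\<lambda>j. mps_coeff (ba_vec e m \<tau> u j) \<alpha>)
        (\<lambda>j. mps_coeff (ba_vec e (r_of e - n_of e - m) \<sigma> v j) \<beta>) = 0)"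
proof -
  let ?X = "\<lambda>\<alpha> j. mps_coeff (ba_vec e m \<tau> u j) \<alpha>"
  let ?X' = "\<lambda>\<beta> j. mps_coeff (ba_vec e (r_of e - n_of e - m) \<sigma> v j) \<beta>"
  define A where "A j = mps_const (fls_X_intpow (1 - of_bool (j = u))) * ba_num \<tau> u j" for j
  define B where "B j = mps_const (fls_X_intpow (- int (e j) - of_bool (j = v))) * mps_neg_vars (ba_num \<sigma> v j)" for j
  have neg_nz: "mps_neg_vars (\<sigma> v v) \<noteq> 0" using nz by simp
  have "T2_fun e (zpow_mult (\<lambda>j. 1 - of_bool (j = u)) (ba \<tau> u))
      (zpow_mult (\<lambda>j. - int (e j) - of_bool (j = v)) (ba_adj \<sigma> v))
    = Fract (T2_outer e A B) (mps_outer (*) (mps_coeff (\<tau> u u)) (mps_coeff (mps_neg_vars (\<sigma> v v))))"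
    by (rule T2_fun_Fract[where e = e, OF e nz(1) neg_nz])
      (simp_all add: zpow_mult_def ba_def ba_adj_def zpow_def A_def B_def mps_neg_vars_map_fls_const)
  moreover have "mps_outer (*) (mps_coeff (\<tau> u u)) (mps_coeff (mps_neg_vars (\<sigma> v v))) \<noteq> 0"
    using mps_nonzero[OF nz(1)] mps_nonzero[OF neg_nz] by (auto simp: mps_outer_eq_0_iff)
  ultimately have "T2_fun e (zpow_mult (\<lambda>j. 1 - of_bool (j = u)) (ba \<tau> u))
      (zpow_mult (\<lambda>j. - int (e j) - of_bool (j = v)) (ba_adj \<sigma> v)) = 0
    \<longleftrightarrow> (\<forall>\<alpha> \<beta>. T2 e (\<lambda>j. mps_coeff (A j) \<alpha>) (\<lambda>j. mps_coeff (B j) \<beta>) = 0)"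
    by (simp add: Zero_fract_def eq_fract mps_outer_eq_0_iff)
  moreover have "T2 e (\<lambda>j. mps_coeff (A j) \<alpha>) (\<lambda>j. mps_coeff (B j) \<beta>)
      = (-1) ^ size \<beta> * T2 e (?X \<alpha>) (?X' \<beta>)" for \<alpha> \<beta>
  proof -
    interpret T: module_hom V_scale "(*)" "\<lambda>a. T2 e a (?X' \<beta>)"
      by (rule V_functional_T2_left[where e = e, OF e])
    have "mps_coeff (A j) \<alpha> * mps_coeff (B j) \<beta>
        = (V_scale ((-1) ^ size \<beta>) (?X \<alpha>) * ?X' \<beta>) j" for j
    proof -
      let ?a = "mps_coeff (ba_num \<tau> u j) \<alpha>" and ?b = "mps_coeff (ba_num \<sigma> v j) \<beta>"
      let ?s = "fls_const ((-1) ^ size \<beta>) :: complex fls"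
      have s: "?s = (-1) ^ size \<beta>" by (simp add: fls_const_power)
      have "mps_coeff (A j) \<alpha> * mps_coeff (B j) \<beta>
          = (fls_X_intpow (1 - of_bool (j = u)) * fls_X_intpow (- int (e j) - of_bool (j = v))) * (?s * (?a * ?b))"
        by (simp add: A_def B_def s ac_simps)
      also have "fls_X_intpow (1 - of_bool (j = u)) * fls_X_intpow (- int (e j) - of_bool (j = v))
          = fls_X_intpow (v_exp e m j - of_bool (j = u))
            * (fls_X_intpow (v_exp e (r_of e - n_of e - m) j - of_bool (j = v)) :: complex fls)"
        unfolding fls_X_intpow_times_fls_X_intpow using v_exp_duality[OF m, of j]
        by (intro arg_cong[of _ _ "\<lambda>k. fls_X_intpow k"]) linarith
      finally show ?thesis
        unfolding times_fun_apply V_scale_def ba_vec_def zpow_def mps_coeff_const_mult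
        by (simp only: ac_simps)
    qed
    then have "T2 e (\<lambda>j. mps_coeff (A j) \<alpha>) (\<lambda>j. mps_coeff (B j) \<beta>)
        = T2 e (V_scale ((-1) ^ size \<beta>) (?X \<alpha>)) (?X' \<beta>)"
      unfolding T2_def by (intro arg_cong[of _ _ "\<lambda>f. fls_residue (Tr e f)"] ext) simp
    then show ?thesis by (simp add: T.scale)
  qed
  ultimately show ?thesis by simp
qed

theorem theorem3p15:
  fixes e :: "'r::{finite,linorder} \<Rightarrow> nat" and m :: int and U U' :: "'r V set"
    and \<tau> \<sigma> \<tau>' \<sigma>' :: "'r \<Rightarrow> 'r \<Rightarrow> 'r OJ"
  assumes "\<And>i. e i > 0"
    and "2 * m \<noteq> r_of e - n_of e"
    and "U \<in> Gr m" and "U' \<in> Gr m"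
    and "normalized e m U \<tau> \<sigma>" and "normalized e m U' \<tau>' \<sigma>'"
  shows "U = U' \<longleftrightarrow>
    (\<forall>u v. T2_fun e
       (zpow_mult (\<lambda>j. 1 - of_bool (j = u)) (ba \<tau> u))
       (zpow_mult (\<lambda>j. - int (e j) - of_bool (j = v)) (ba_adj \<sigma>' v)) = 0)"
proof -
  let ?m' = "r_of e - n_of e - m"
  let ?X = "\<lambda>u \<alpha> j. mps_coeff (ba_vec e m \<tau> u j) \<alpha>"
  let ?X' = "\<lambda>v \<beta> j. mps_coeff (ba_vec e ?m' \<sigma>' v j) \<beta>"
  note e = assms(1)
  have \<tau>: "tau_system e m U \<tau>" and \<sigma>': "tau_system e ?m' (orth e U') \<sigma>'"
    using assms(5,6) by (simp_all add: normalized_def)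
  have X: "?X u \<alpha> \<in> U" for u \<alpha> by (rule normalized_ba_vec_in[OF assms(5)])
  have X': "?X' v \<beta> \<in> orth e U'" for v \<beta>
    by (rule normalized_adj_ba_vec_in[where e = e, OF e assms(6)])
  have "T2_fun e (zpow_mult (\<lambda>j. 1 - of_bool (j = u)) (ba \<tau> u))
      (zpow_mult (\<lambda>j. - int (e j) - of_bool (j = v)) (ba_adj \<sigma>' v)) = 0
      \<longleftrightarrow> (\<forall>\<alpha> \<beta>. T2 e (?X u \<alpha>) (?X' v \<beta>) = 0)" for u v
    by (rule T2_fun_ba_eq_0_iff[where e = e, OF e assms(2)])
      (use \<tau> \<sigma>' in \<open>auto simp: tau_system_def\<close>)
  moreover have "U = U' \<longleftrightarrow> (\<forall>u v \<alpha> \<beta>. T2 e (?X u \<alpha>) (?X' v \<beta>) = 0)"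
  proof
    assume "U = U'"
    then show "\<forall>u v \<alpha> \<beta>. T2 e (?X u \<alpha>) (?X' v \<beta>) = 0"
      using X X' by (auto simp: orth_def)
  next
    assume zero: "\<forall>u v \<alpha> \<beta>. T2 e (?X u \<alpha>) (?X' v \<beta>) = 0"
    have step1: "T2 e x (?X' v \<beta>) = 0" if "x \<in> U" for x v \<beta>
    proof -
      interpret T: module_hom V_scale "(*)" "\<lambda>x. T2 e x (?X' v \<beta>)"
        by (rule V_functional_T2_left[where e = e, OF e])
      have "x \<in> V.span (\<Union>u. range (?X u))"
        using ba_vec_coeffs_span[OF \<tau> X] that by blast
      then show ?thesis
        by (rule T.eq_0_on_span[rotated]) (use zero in auto)
    qed
    have step2: "T2 e x y = 0" if "x \<in> U" "y \<in> orth e U'" for x y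
    proof -
      interpret T: module_hom V_scale "(*)" "T2 e x"
        by (rule V_functional_T2_right[where e = e, OF e])
      have "y \<in> V.span (\<Union>v. range (?X' v))"
        using ba_vec_coeffs_span[OF \<sigma>' X'] that by blast
      then show ?thesis
        by (rule T.eq_0_on_span[rotated]) (use step1 that in auto)
    qed
    have "U \<subseteq> U'"
    proof (rule subsetI, rule ccontr)
      fix x assume x: "x \<in> U" "x \<notin> U'"
      obtain y where "y \<in> orth e U'" "T2 e x y \<noteq> 0"
        by (rule orth_separates_Gr[where e = e, OF e assms(4) x(2)]) blast
      then show False using step2 x(1) by simp
    qed
    then show "U = U'" by (rule Gr_subset_imp_eq[OF assms(3,4)])
  qed
  ultimately show ?thesis by simp
qed

end
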